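(* Let $Y$ be a separable non-reflexive Banach space over $\mathbb{K}$ ($\mathbb{K}=\mathbb{R}$ or $\mathbb{C}$) which does not contain an isomorphic copy of $\ell_1$ (in particular, this applies if $Y$ is non-reflexive and $Y^*$ is separable). Then $\mathrm{QNA}(\ell_1,Y^{**})\neq w^*\mathrm{QNA}(\ell_1,Y^{**})$.
   Context: Banach spaces (including $\ell_1$) are over the same scalar field $\mathbb{K}=\mathbb{R}$ or $\mathbb{C}$. $B_X$ is the closed unit ball of $X$ and $X^*$ its topological dual. For a bounded linear operator $T\colon X\to Z^*$: $T\in\mathrm{QNA}(X,Z^* )$ if the norm closure of $T(B_X)$ intersects the sphere $\{u^*\in Z^*:\|u^*\|=\|T\|\}$; $T\in w^*\mathrm{QNA}(X,Z^* )$ if the $\sigma(Z^*,Z)$-closure of $T(B_X)$ intersects the sphere $\{u^*\in Z^*:\|u^*\|=\|T\|\}$. For range space $Y^{**}$, this is applied with $Z=Y^*$, i.e. with the topology $\sigma(Y^{**},Y^* )$. *)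

theory Defs
  imports "HOL-Analysis.Analysis" "HOL-Library.Function_Algebras"
begin

section \<open>The scalar field\<close>

text \<open>
  The scalar field is either \<open>\<real>\<close> or \<open>\<complex>\<close>: the class collects the normed fields that are
  isometrically isomorphic, as fields, to one of the two.
\<close>

class real_or_complex = real_normed_field +
  assumes real_or_complex:
    "(\<exists>h :: 'a \<Rightarrow> real. bij h \<and> (\<forall>x y. h (x + y) = h x + h y) \<and>
        (\<forall>x y. h (x * y) = h x * h y) \<and> (\<forall>x. norm (h x) = norm x)) \<or>
     (\<exists>h :: 'a \<Rightarrow> complex. bij h \<and> (\<forall>x y. h (x + y) = h x + h y) \<and>
        (\<forall>x y. h (x * y) = h x * h y) \<and> (\<forall>x. norm (h x) = norm x))"

instance real :: real_or_complex
  by standard (rule disjI1, rule exI[of _ id], simp)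

instance complex :: real_or_complex
  by standard (rule disjI2, rule exI[of _ id], simp)


section \<open>Normed spaces over the scalar field\<close>

text \<open>
  A Banach space over \<open>'k\<close> is given on a type of class \<open>banach\<close> by its scalar multiplication
  \<open>scaleK\<close>; the real structure of the class is the restriction of scalars.
\<close>

locale normed_scaling = vector_space scaleK
  for scaleK :: "'k::real_or_complex \<Rightarrow> 'v::real_normed_vector \<Rightarrow> 'v" +
  assumes norm_scale: "norm (scaleK c x) = norm c * norm x"
    and scale_of_real: "scaleK (of_real r) x = r *\<^sub>R x"

text \<open>
  Since the dual depends on the scalar multiplication and not only on a type, duals and operator
  spaces are described by a carrier set, a scalar multiplication and a norm. Addition is that of
  the ambient type (pointwise on functions).
\<close>

record ('k, 'v) kspace =
  carr :: "'v set"
  smul :: "'k \<Rightarrow> 'v \<Rightarrow> 'v"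
  nrm :: "'v \<Rightarrow> real"

definition space_of :: "('k \<Rightarrow> 'v \<Rightarrow> 'v) \<Rightarrow> ('k, 'v::real_normed_vector) kspace" where
  "space_of scaleK = \<lparr>carr = UNIV, smul = scaleK, nrm = norm\<rparr>"

definition scalars :: "('k::real_or_complex, 'k) kspace" where
  "scalars = space_of (*)"

definition ell1 :: "('k::real_or_complex, nat \<Rightarrow> 'k) kspace" where
  "ell1 = \<lparr>carr = {a. summable (\<lambda>n. norm (a n))},
           smul = (\<lambda>c a n. c * a n),
           nrm = (\<lambda>a. \<Sum>n. norm (a n))\<rparr>"

definition unit_ball :: "('k, 'v) kspace \<Rightarrow> 'v set" where
  "unit_ball X = {x \<in> carr X. nrm X x \<le> 1}"

text \<open>
  The distance is cut off outside the carrier because \<^locale>\<open>Metric_space\<close> asks for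
  nonnegativity and symmetry on the whole type.
\<close>

definition norm_topology :: "('k, 'v::ab_group_add) kspace \<Rightarrow> 'v topology" where
  "norm_topology X = Metric_space.mtopology (carr X)
     (\<lambda>x y. if x \<in> carr X \<and> y \<in> carr X then nrm X (x - y) else 0)"

text \<open>
  Bounded linear operators, with the operator norm. An operator is represented by a function on
  the ambient type that vanishes outside the carrier, so that equality of functions is equality of
  operators.
\<close>

definition bounded_operators ::
  "('k, 'v::ab_group_add) kspace \<Rightarrow> ('k, 'w::ab_group_add) kspace \<Rightarrow> ('v \<Rightarrow> 'w) set" where
  "bounded_operators X W = {T.
     (\<forall>x\<in>carr X. T x \<in> carr W) \<and> (\<forall>x. x \<notin> carr X \<longrightarrow> T x = 0) \<and>
     (\<forall>x\<in>carr X. \<forall>y\<in>carr X. T (x + y) = T x + T y) \<and>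
     (\<forall>c. \<forall>x\<in>carr X. T (smul X c x) = smul W c (T x)) \<and>
     (\<exists>C. \<forall>x\<in>carr X. nrm W (T x) \<le> C * nrm X x)}"

definition operator_space ::
  "('k, 'v::ab_group_add) kspace \<Rightarrow> ('k, 'w::ab_group_add) kspace \<Rightarrow> ('k, 'v \<Rightarrow> 'w) kspace" where
  "operator_space X W = \<lparr>carr = bounded_operators X W,
     smul = (\<lambda>c T x. smul W c (T x)),
     nrm = (\<lambda>T. SUP x\<in>unit_ball X. nrm W (T x))\<rparr>"

definition dual :: "('k::real_or_complex, 'v::ab_group_add) kspace \<Rightarrow> ('k, 'v \<Rightarrow> 'k) kspace" where
  "dual Z = operator_space Z scalars"

text \<open>The topology \<open>\<sigma>(Z\<^sup>*, Z)\<close> on \<open>Z\<^sup>*\<close>: the coarsest one making all evaluations continuous.\<close>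

definition weak_star_topology ::
  "('k::real_or_complex, 'v::ab_group_add) kspace \<Rightarrow> ('v \<Rightarrow> 'k) topology" where
  "weak_star_topology Z = topology_generated_by
     {{u \<in> carr (dual Z). u z \<in> U} | z U. z \<in> carr Z \<and> open U}"


section \<open>Reflexivity and copies of other spaces\<close>

definition canonical_embedding ::
  "('k::real_or_complex, 'v::ab_group_add) kspace \<Rightarrow> 'v \<Rightarrow> ('v \<Rightarrow> 'k) \<Rightarrow> 'k" where
  "canonical_embedding Y y = (\<lambda>f. if f \<in> carr (dual Y) then f y else 0)"

definition reflexive :: "('k::real_or_complex, 'v::ab_group_add) kspace \<Rightarrow> bool" where
  "reflexive Y \<longleftrightarrow> canonical_embedding Y ` carr Y = carr (dual (dual Y))"

definition linear_subspace :: "('k, 'v::ab_group_add) kspace \<Rightarrow> 'v set \<Rightarrow> bool" where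
  "linear_subspace Y M \<longleftrightarrow> M \<subseteq> carr Y \<and> 0 \<in> M \<and>
     (\<forall>x\<in>M. \<forall>y\<in>M. x + y \<in> M) \<and> (\<forall>c. \<forall>x\<in>M. smul Y c x \<in> M)"

definition isomorphic_spaces ::
  "('k, 'v::ab_group_add) kspace \<Rightarrow> ('k, 'w::ab_group_add) kspace \<Rightarrow> bool" where
  "isomorphic_spaces X W \<longleftrightarrow>
     (\<exists>S\<in>bounded_operators X W. \<exists>R\<in>bounded_operators W X.
        (\<forall>x\<in>carr X. R (S x) = x) \<and> (\<forall>w\<in>carr W. S (R w) = w))"

definition contains_copy_of ::
  "('k, 'v::ab_group_add) kspace \<Rightarrow> ('k, 'w::ab_group_add) kspace \<Rightarrow> bool" where
  "contains_copy_of Y X \<longleftrightarrow>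
     (\<exists>M. linear_subspace Y M \<and> isomorphic_spaces X (Y\<lparr>carr := M\<rparr>))"


section \<open>Quasi norm attaining operators\<close>

text \<open>
  \<open>QNA X Z\<close> and \<open>wstar_QNA X Z\<close> are the sets written \<open>QNA(X, Z\<^sup>*)\<close> and \<open>w\<^sup>*QNA(X, Z\<^sup>*)\<close>:
  the second argument is the predual of the range.
\<close>

definition QNA ::
  "('k::real_or_complex, 'v::ab_group_add) kspace \<Rightarrow> ('k, 'w::ab_group_add) kspace
     \<Rightarrow> ('v \<Rightarrow> 'w \<Rightarrow> 'k) set" where
  "QNA X Z = {T \<in> bounded_operators X (dual Z).
     (norm_topology (dual Z) closure_of (T ` unit_ball X)) \<inter>
     {u \<in> carr (dual Z). nrm (dual Z) u = nrm (operator_space X (dual Z)) T} \<noteq> {}}"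

definition wstar_QNA ::
  "('k::real_or_complex, 'v::ab_group_add) kspace \<Rightarrow> ('k, 'w::ab_group_add) kspace
     \<Rightarrow> ('v \<Rightarrow> 'w \<Rightarrow> 'k) set" where
  "wstar_QNA X Z = {T \<in> bounded_operators X (dual Z).
     (weak_star_topology Z closure_of (T ` unit_ball X)) \<inter>
     {u \<in> carr (dual Z). nrm (dual Z) u = nrm (operator_space X (dual Z)) T} \<noteq> {}}"

end

theory Submission
  imports Defs
begin

text \<open>
  Let \<open>\<phi> \<in> Y\<^sup>*\<^sup>*\<close> have norm 1 and not come from \<open>Y\<close>. Separability yields a sequence \<open>f i\<close> in \<open>Y\<^sup>*\<close> that
  norms \<open>\<phi>\<close>, separates \<open>\<phi>\<close> from every element of \<open>Y\<close> and separates the points of \<open>Y\<close>. By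
  Goldstine's theorem there are \<open>x n \<in> Y\<close> of norm at most \<open>1 - 1 / (n + 2)\<close> with
  \<open>f i (x n) \<longlonglongrightarrow> \<phi> (f i)\<close> for every \<open>i\<close>. The operator \<open>T\<close> maps the \<open>n\<close>-th unit vector to
  \<open>x n\<close>. A weak-star cluster point of \<open>x n\<close> agrees with \<open>\<phi>\<close> on all \<open>f i\<close>, so it has norm \<open>1 = \<parallel>T\<parallel>\<close>.
  A norm limit \<open>w\<close> of norm 1 of images of the unit ball can only use late indices, which forces
  \<open>f i w = c * \<phi> (f i)\<close> for a constant \<open>c\<close>; then \<open>c = 0\<close> gives \<open>w = 0\<close>, and otherwise \<open>w / c \<in> Y\<close> is
  not separated from \<open>\<phi>\<close>. A cluster point takes the place of the weak-star limit that the
  Odell-Rosenthal theorem would provide.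
\<close>


section \<open>Embedding the scalars into the complex numbers\<close>

text \<open>Both admissible scalar fields become subfields of the complex numbers, so real parts,
  conjugates and compactness can be treated once. In the real case the isomorphism is followed by
  \<open>complex_of_real\<close>.\<close>

lemma ex_scalar_embedding:
  "\<exists>H :: 'k::real_or_complex \<Rightarrow> complex. (\<forall>x y. H (x + y) = H x + H y) \<and>
     (\<forall>x y. H (x * y) = H x * H y) \<and> (\<forall>x. norm (H x) = norm x) \<and>
     (range H = UNIV \<or> range H = \<real>)"
  using real_or_complex[where 'a = 'k]
proof
  assume "\<exists>h :: 'k \<Rightarrow> real. bij h \<and> (\<forall>x y. h (x + y) = h x + h y) \<and>
    (\<forall>x y. h (x * y) = h x * h y) \<and> (\<forall>x. norm (h x) = norm x)"
  then obtain h :: "'k \<Rightarrow> real" where h: "bij h" "\<forall>x y. h (x + y) = h x + h y"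
    "\<forall>x y. h (x * y) = h x * h y" "\<forall>x. norm (h x) = norm x"
    by blast
  have "range (\<lambda>x. complex_of_real (h x)) = \<real>"
    using bij_is_surj[OF h(1)] by (metis Reals_def image_image)
  with h show ?thesis
    by (intro exI[of _ "\<lambda>x. complex_of_real (h x)"]) simp
qed (metis bij_is_surj)

definition scalar_embedding :: "'k::real_or_complex \<Rightarrow> complex" where
  "scalar_embedding = (SOME H. (\<forall>x y. H (x + y) = H x + H y) \<and>
     (\<forall>x y. H (x * y) = H x * H y) \<and> (\<forall>x. norm (H x) = norm x) \<and>
     (range H = UNIV \<or> range H = \<real>))"

lemma
  fixes x y :: "'k::real_or_complex"
  shows scalar_embedding_add: "scalar_embedding (x + y) = scalar_embedding x + scalar_embedding y"
    and scalar_embedding_mult: "scalar_embedding (x * y) = scalar_embedding x * scalar_embedding y"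
    and norm_scalar_embedding: "norm (scalar_embedding x) = norm x"
    and range_scalar_embedding:
      "range (scalar_embedding :: 'k \<Rightarrow> complex) = UNIV \<or>
       range (scalar_embedding :: 'k \<Rightarrow> complex) = \<real>"
  using someI_ex[OF ex_scalar_embedding[where 'k = 'k], folded scalar_embedding_def] by simp_all

lemma scalar_embedding_diff:
  "scalar_embedding (x - y) = scalar_embedding x - scalar_embedding y"
  by (metis add_diff_cancel_right' diff_add_cancel scalar_embedding_add)

lemma scalar_embedding_eq_iff: "scalar_embedding x = scalar_embedding y \<longleftrightarrow> x = y"
  by (metis norm_eq_zero norm_scalar_embedding right_minus_eq scalar_embedding_diff)

lemma scalar_embedding_zero [simp]: "scalar_embedding 0 = 0"
  by (metis norm_eq_zero norm_scalar_embedding)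

lemma scalar_embedding_one [simp]: "scalar_embedding (1 :: 'k::real_or_complex) = 1"
proof -
  have "scalar_embedding (1 :: 'k) * scalar_embedding (1 :: 'k) = scalar_embedding (1 :: 'k)"
    using scalar_embedding_mult[of "1 :: 'k" 1] by simp
  moreover have "scalar_embedding (1 :: 'k) \<noteq> 0"
    using norm_scalar_embedding[of "1 :: 'k"] by auto
  ultimately show ?thesis by simp
qed

text \<open>Additivity, multiplicativity and isometry do not include real linearity, so it is
  recovered metrically: the image has distance \<open>abs r\<close> from 0 and
  \<open>abs (r - 1)\<close> from 1, and these two circles touch only at \<open>r\<close>.\<close>

lemma scalar_embedding_of_real: "scalar_embedding (of_real r :: 'k::real_or_complex) = of_real r"
proof -
  let ?w = "scalar_embedding (of_real r :: 'k)"
  have "norm ?w = \<bar>r\<bar>"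
    by (simp add: norm_scalar_embedding)
  then have 1: "(Re ?w)\<^sup>2 + (Im ?w)\<^sup>2 = r\<^sup>2"
    using cmod_power2[of ?w] by simp
  have "norm (?w - 1) = norm (of_real r - 1 :: 'k)"
    using norm_scalar_embedding[of "of_real r - 1 :: 'k"] by (simp add: scalar_embedding_diff)
  also have "\<dots> = \<bar>r - 1\<bar>"
    using norm_of_real[of "r - 1", where 'a = 'k] by simp
  finally have 2: "(Re ?w - 1)\<^sup>2 + (Im ?w)\<^sup>2 = (r - 1)\<^sup>2"
    using cmod_power2[of "?w - 1"] by simp
  have re: "Re ?w = r"
    using 1 2 by (simp add: power2_eq_square algebra_simps)
  with 1 have "Im ?w = 0"
    by simp
  with re show ?thesis
    by (simp add: complex_eq_iff)
qed

section \<open>Real part, conjugation and compactness in the scalar field\<close>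

definition scalar_Re :: "'k::real_or_complex \<Rightarrow> real" where
  "scalar_Re c = Re (scalar_embedding c)"

text \<open>The choice is well defined because the range of the embedding, all complex numbers or
  the reals, is closed under conjugation.\<close>

definition scalar_cnj :: "'k::real_or_complex \<Rightarrow> 'k" where
  "scalar_cnj c = (SOME d. scalar_embedding d = cnj (scalar_embedding c))"

lemma scalar_embedding_cnj: "scalar_embedding (scalar_cnj c) = cnj (scalar_embedding c)"
proof -
  have "cnj (scalar_embedding c) \<in> range (scalar_embedding :: 'a \<Rightarrow> complex)"
    using range_scalar_embedding[where 'k = 'a]
    by (metis Reals_cnj_iff UNIV_I rangeI)
  then obtain d :: 'a where "scalar_embedding d = cnj (scalar_embedding c)"
    by (metis imageE)
  then show ?thesis
    unfolding scalar_cnj_def by (rule someI)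
qed

lemma scalar_Re_add: "scalar_Re (x + y) = scalar_Re x + scalar_Re y"
  by (simp add: scalar_Re_def scalar_embedding_add)

lemma scalar_Re_diff: "scalar_Re (x - y) = scalar_Re x - scalar_Re y"
  by (simp add: scalar_Re_def scalar_embedding_diff)

lemma scalar_Re_sum: "scalar_Re (sum f A) = (\<Sum>i\<in>A. scalar_Re (f i))"
  by (induction A rule: infinite_finite_induct) (simp_all add: scalar_Re_add, simp_all add: scalar_Re_def)

lemma scalar_Re_le_norm: "scalar_Re c \<le> norm c"
  by (metis complex_Re_le_cmod norm_scalar_embedding scalar_Re_def)

lemma scalar_Re_of_real [simp]: "scalar_Re (of_real r) = r"
  by (simp add: scalar_Re_def scalar_embedding_of_real)

lemma ex_unimodular_rotation:
  fixes c :: "'k::real_or_complex"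
  obtains u where "norm u = 1" "u * c = of_real (norm c)"
proof (cases "c = 0")
  case True
  with that[of 1] show ?thesis by simp
next
  case False
  with that[of "of_real (norm c) / c"] show ?thesis by (simp add: norm_divide)
qed

lemma scalar_Re_cnj_mult_self: "scalar_Re (scalar_cnj c * c) = (norm c)\<^sup>2"
  unfolding scalar_Re_def scalar_embedding_mult scalar_embedding_cnj
  by (metis complex_norm_square mult.commute norm_scalar_embedding of_real_power Re_complex_of_real)

text \<open>The quadratic expansion in \<open>t\<close> that drives the variational proof of
  \<open>Goldstine\<close>.\<close>

lemma norm_diff_power2_scalar:
  fixes a b :: "'k::real_or_complex"
  shows "(norm (a - of_real t * b))\<^sup>2 =
    (norm a)\<^sup>2 - 2 * t * scalar_Re (scalar_cnj a * b) + t\<^sup>2 * (norm b)\<^sup>2"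
proof -
  have "(norm (a - of_real t * b))\<^sup>2 =
      (norm (scalar_embedding a - of_real t * scalar_embedding b))\<^sup>2"
    by (metis norm_scalar_embedding scalar_embedding_diff scalar_embedding_mult
        scalar_embedding_of_real)
  also have "\<dots> = (norm (scalar_embedding a))\<^sup>2
      - 2 * t * Re (cnj (scalar_embedding a) * scalar_embedding b)
      + t\<^sup>2 * (norm (scalar_embedding b))\<^sup>2"
    unfolding cmod_power2 by (simp add: power2_eq_square algebra_simps)
  finally show ?thesis
    by (simp add: norm_scalar_embedding scalar_Re_def scalar_embedding_mult scalar_embedding_cnj)
qed

text \<open>The class carries no compactness of its own. The range of the embedding is closed, so
  its intersection with a closed disc is compact, and the isometric inverse carries this set onto
  the ball.\<close>

lemma compact_cball_scalar: "compact (cball 0 r :: 'k::real_or_complex set)"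
proof -
  let ?H = "scalar_embedding :: 'k \<Rightarrow> complex"
  have cont: "continuous_on (range ?H) (inv ?H)"
  proof -
    have "dist (inv ?H y) (inv ?H x) = dist y x" if "x \<in> range ?H" "y \<in> range ?H" for x y
      by (metis dist_norm f_inv_into_f norm_scalar_embedding scalar_embedding_diff that)
    then show ?thesis
      unfolding continuous_on_iff by metis
  qed
  have "closed (range ?H)"
    using range_scalar_embedding[where 'k = 'k] by (auto simp: closed_complex_Reals)
  then have "compact (cball 0 r \<inter> range ?H)"
    by (intro compact_Int_closed) auto
  then have "compact (inv ?H ` (cball 0 r \<inter> range ?H))"
    by (intro compact_continuous_image continuous_on_subset[OF cont]) auto
  moreover have "inv ?H ` (cball 0 r \<inter> range ?H) = cball 0 r"
  proof -
    have inv: "inv ?H (?H x) = x" for x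
      by (rule inv_f_f) (simp add: inj_def scalar_embedding_eq_iff)
    have "cball 0 r \<inter> range ?H = ?H ` cball 0 r"
      by (auto simp: norm_scalar_embedding)
    then show ?thesis
      by (simp add: image_image inv)
  qed
  ultimately show ?thesis by simp
qed


section \<open>The Hahn-Banach theorem\<close>

definition sublinear :: "('v::real_vector \<Rightarrow> real) \<Rightarrow> bool" where
  "sublinear p \<longleftrightarrow> (\<forall>x y. p (x + y) \<le> p x + p y) \<and> (\<forall>t x. 0 \<le> t \<longrightarrow> p (t *\<^sub>R x) = t * p x)"

lemma sublinear_zero: "sublinear p \<Longrightarrow> p 0 = 0"
  unfolding sublinear_def by (metis mult_zero_left order_refl scaleR_zero_left)

lemma sublinear_minus: "sublinear p \<Longrightarrow> - p (- x) \<le> p x"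
proof -
  assume p: "sublinear p"
  then have "p (x + - x) \<le> p x + p (- x)"
    unfolding sublinear_def by blast
  with sublinear_zero[OF p] show ?thesis by simp
qed

text \<open>The witness is the infimum over \<open>t \<ge> 0\<close> of
  \<open>p (x + t *\<^sub>R y) - t * p y\<close>, which is finite because \<open>- p (- x)\<close>
  bounds it below. Taking \<open>t = 0\<close> gives \<open>q \<le> p\<close>, and
  \<open>t = 1\<close> at \<open>- y\<close> gives the last claim. Subadditivity adds the parameters
  of two points, homogeneity rescales them.\<close>

lemma sublinear_directional_Inf:
  fixes p :: "'v::real_vector \<Rightarrow> real" and y :: 'v
  assumes p: "sublinear p"
  obtains q where "sublinear q" "q \<le> p" "q (- y) \<le> - p y"
proof -
  define q where "q = (\<lambda>x. INF t\<in>{0..}. p (x + t *\<^sub>R y) - t * p y)"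
  have sub: "p (a + b) \<le> p a + p b" for a b
    using p by (simp add: sublinear_def)
  have hom: "p (t *\<^sub>R a) = t * p a" if "0 \<le> t" for t a
    using p that by (simp add: sublinear_def)
  have lower: "- p (- x) \<le> p (x + t *\<^sub>R y) - t * p y" if "0 \<le> t" for x t
    using sub[of "x + t *\<^sub>R y" "- x"] hom[OF that, of y] by simp
  have bdd: "bdd_below ((\<lambda>t. p (x + t *\<^sub>R y) - t * p y) ` {0..})" for x
    using lower[of _ x] by (intro bdd_belowI[of _ "- p (- x)"]) auto
  have q_le: "q x \<le> p (x + t *\<^sub>R y) - t * p y" if "0 \<le> t" for x t
    unfolding q_def by (rule cINF_lower[OF bdd[of x]]) (use that in auto)
  have q_ge: "c \<le> q x" if "\<And>t. 0 \<le> t \<Longrightarrow> c \<le> p (x + t *\<^sub>R y) - t * p y" for x c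
    unfolding q_def by (rule cINF_greatest) (use that in auto)
  have le: "q \<le> p"
    using q_le[of 0] by (auto simp: le_fun_def)
  have neg: "q (- y) \<le> - p y"
    using q_le[of 1 "- y"] sublinear_zero[OF p] by simp
  have scale_le: "q (t *\<^sub>R x) \<le> t * q x" if t: "0 < t" for t x
  proof -
    have "q (t *\<^sub>R x) / t \<le> q x"
    proof (rule q_ge)
      fix s :: real assume s: "0 \<le> s"
      have "q (t *\<^sub>R x) \<le> p (t *\<^sub>R (x + s *\<^sub>R y)) - (t * s) * p y"
        using q_le[of "t * s" "t *\<^sub>R x"] s t by (simp add: scaleR_add_right)
      also have "\<dots> = t * (p (x + s *\<^sub>R y) - s * p y)"
        using hom[of t "x + s *\<^sub>R y"] t by (simp add: right_diff_distrib mult.assoc)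
      finally show "q (t *\<^sub>R x) / t \<le> p (x + s *\<^sub>R y) - s * p y"
        using t by (simp add: divide_le_eq mult.commute)
    qed
    with t show ?thesis by (simp add: divide_le_eq mult.commute)
  qed
  have "sublinear q"
    unfolding sublinear_def
  proof (intro conjI allI impI)
    fix x z
    have "q (x + z) - (p (z + t *\<^sub>R y) - t * p y) \<le> q x" if t: "0 \<le> t" for t
    proof (rule q_ge)
      fix s :: real assume s: "0 \<le> s"
      have "q (x + z) \<le> p ((x + s *\<^sub>R y) + (z + t *\<^sub>R y)) - (s + t) * p y"
        using q_le[of "s + t" "x + z"] s t by (simp add: algebra_simps)
      then show "q (x + z) - (p (z + t *\<^sub>R y) - t * p y) \<le> p (x + s *\<^sub>R y) - s * p y"
        using sub[of "x + s *\<^sub>R y" "z + t *\<^sub>R y"] by (simp add: algebra_simps)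
    qed
    then have "q (x + z) - q x \<le> q z"
      by (intro q_ge) (simp add: algebra_simps)
    then show "q (x + z) \<le> q x + q z" by simp
  next
    fix t :: real and x assume t: "0 \<le> t"
    show "q (t *\<^sub>R x) = t * q x"
    proof (cases "t = 0")
      case True
      have "q 0 = 0"
        using q_le[of 0 0] q_ge[of 0 0] sublinear_zero[OF p] hom by (intro antisym) auto
      with True show ?thesis by simp
    next
      case False
      with t have "0 < t" by simp
      moreover have "q x \<le> (1 / t) * q (t *\<^sub>R x)"
        using scale_le[of "1 / t" "t *\<^sub>R x"] \<open>0 < t\<close> by simp
      ultimately show ?thesis
        using scale_le[of t x] by (intro antisym) (simp_all add: field_simps)
    qed
  qed
  from this le neg show thesis by (rule that)
qed

text \<open>Supplies the lower bound of a chain for Zorn's lemma. Of two members of the chain one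
  lies below both, so a single functional estimates both summands and subadditivity survives the
  infimum. The common majorant \<open>p0\<close> keeps the infimum finite through
  \<open>- p0 (- x)\<close>.\<close>

lemma sublinear_chain_Inf:
  fixes C :: "('v::real_vector \<Rightarrow> real) set"
  assumes "C \<noteq> {}" and C: "\<And>p. p \<in> C \<Longrightarrow> sublinear p \<and> p \<le> p0"
    and chain: "\<And>p q. p \<in> C \<Longrightarrow> q \<in> C \<Longrightarrow> p \<le> q \<or> q \<le> p"
  defines "m \<equiv> \<lambda>x. INF p\<in>C. p x"
  shows "sublinear m" "\<And>p. p \<in> C \<Longrightarrow> m \<le> p"
proof -
  have bdd: "bdd_below ((\<lambda>p. p x) ` C)" for x
  proof (intro bdd_belowI2)
    fix p assume "p \<in> C"
    with C[of p] show "- p0 (- x) \<le> p x"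
      using sublinear_minus[of p x] le_funD[of p p0 "- x"] by linarith
  qed
  have m_le: "m x \<le> p x" if "p \<in> C" for p x
    unfolding m_def by (rule cINF_lower[OF bdd[of x] that])
  have m_ge: "c \<le> m x" if "\<And>p. p \<in> C \<Longrightarrow> c \<le> p x" for c x
    unfolding m_def by (rule cINF_greatest[OF assms(1) that])
  show "m \<le> p" if "p \<in> C" for p
    using m_le[OF that] by (simp add: le_fun_def)
  have scale_le: "m (t *\<^sub>R x) \<le> t * m x" if "0 < t" for t x
  proof -
    have "m (t *\<^sub>R x) / t \<le> m x"
    proof (rule m_ge)
      fix p assume p: "p \<in> C"
      have "m (t *\<^sub>R x) \<le> t * p x"
        using m_le[OF p, of "t *\<^sub>R x"] C[OF p] that by (simp add: sublinear_def)
      with that show "m (t *\<^sub>R x) / t \<le> p x" by (simp add: divide_le_eq mult.commute)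
    qed
    with that show ?thesis by (simp add: divide_le_eq mult.commute)
  qed
  show "sublinear m"
    unfolding sublinear_def
  proof (intro conjI allI impI)
    fix x y
    have "m (x + y) - q y \<le> m x" if q: "q \<in> C" for q
    proof (rule m_ge)
      fix p assume p: "p \<in> C"
      from chain[OF p q] obtain r where r: "r \<in> C" "r \<le> p" "r \<le> q"
        using p q by auto
      have "m (x + y) \<le> r x + r y"
        using m_le[OF r(1), of "x + y"] C[OF r(1)] by (auto simp: sublinear_def intro: order_trans)
      with r(2,3) show "m (x + y) - q y \<le> p x"
        by (smt (verit) le_funD)
    qed
    then have "m (x + y) - m x \<le> m y"
      by (intro m_ge) (simp add: algebra_simps)
    then show "m (x + y) \<le> m x + m y" by simp
  next
    fix t :: real and x assume t: "0 \<le> t"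
    show "m (t *\<^sub>R x) = t * m x"
    proof (cases "t = 0")
      case True
      have "\<And>p. p \<in> C \<Longrightarrow> p 0 = 0" using C sublinear_zero by blast
      then have "(\<lambda>p. p 0) ` C = {0}" using assms(1) by force
      then have "m 0 = 0" by (simp add: m_def)
      with True show ?thesis by simp
    next
      case False
      with t have "0 < t" by simp
      moreover have "m x \<le> (1 / t) * m (t *\<^sub>R x)"
        using scale_le[of "1 / t" "t *\<^sub>R x"] \<open>0 < t\<close> by simp
      ultimately show ?thesis
        using scale_le[of t x] by (intro antisym) (simp_all add: field_simps)
    qed
  qed
qed

text \<open>A minimal sublinear functional is linear, because it is not decreased by
  \<open>sublinear_directional_Inf\<close> in any direction.\<close>

lemma linear_below_sublinear:
  fixes p0 :: "'v::real_vector \<Rightarrow> real"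
  assumes p0: "sublinear p0"
  obtains f where "linear f" "\<And>x. f x \<le> p0 x"
proof -
  define A where "A = {p. sublinear p \<and> p \<le> p0}"
  \<comment> \<open>The order is reversed, so the maximal element that Zorn's lemma provides is a
    minimal functional.\<close>
  let ?P = "\<lambda>p q :: 'v \<Rightarrow> real. q \<le> p"
  have "\<exists>m\<in>A. \<forall>a\<in>A. a \<le> m \<longrightarrow> a = m"
  proof (rule predicate_Zorn)
    show "partial_order_on A (relation_of ?P A)"
      by (rule partial_order_on_relation_ofI) auto
    fix C assume C: "C \<in> Chains (relation_of ?P A)"
    then have CA: "C \<subseteq> A" and chain: "\<And>p q. p \<in> C \<Longrightarrow> q \<in> C \<Longrightarrow> p \<le> q \<or> q \<le> p"
      by (auto simp: Chains_def relation_of_def)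
    show "\<exists>u\<in>A. \<forall>a\<in>C. u \<le> a"
    proof (cases "C = {}")
      case True
      with p0 show ?thesis by (auto simp: A_def)
    next
      case False
      have "\<And>p. p \<in> C \<Longrightarrow> sublinear p \<and> p \<le> p0"
        using CA by (auto simp: A_def)
      note inf = sublinear_chain_Inf[OF False this chain]
      obtain q where "q \<in> C"
        using False by blast
      then have "(\<lambda>x. INF p\<in>C. p x) \<le> p0"
        using inf(2)[of q] CA by (auto simp: A_def intro: order_trans)
      with inf show ?thesis
        by (intro bexI[of _ "\<lambda>x. INF p\<in>C. p x"]) (auto simp: A_def)
    qed
  qed
  then obtain p where p: "sublinear p" "p \<le> p0"
    and minimal: "\<And>q. sublinear q \<Longrightarrow> q \<le> p0 \<Longrightarrow> q \<le> p \<Longrightarrow> q = p"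
    by (auto simp: A_def)
  have neg: "p (- y) = - p y" for y
  proof -
    obtain q where q: "sublinear q" "q \<le> p" "q (- y) \<le> - p y"
      using sublinear_directional_Inf[OF p(1)] by blast
    have "q = p"
      using q(1) order_trans[OF q(2) p(2)] q(2) by (rule minimal)
    with q(3) sublinear_minus[OF p(1), of y] show ?thesis by simp
  qed
  have sub: "p (x + y) \<le> p x + p y" for x y
    using p(1) by (simp add: sublinear_def)
  have hom: "p (t *\<^sub>R x) = t * p x" if "0 \<le> t" for t x
    using p(1) that by (simp add: sublinear_def)
  have "linear p"
  proof (rule linearI)
    show "p (x + y) = p x + p y" for x y
      using sub[of x y] sub[of "- x" "- y"] neg[of "x + y"] neg[of x] neg[of y]
      by simp
    show "p (t *\<^sub>R x) = t *\<^sub>R p x" for t x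
    proof (cases "0 \<le> t")
      case False
      then show ?thesis
        using hom[of "- t" x] neg[of "t *\<^sub>R x"] by simp
    qed (simp add: hom)
  qed
  with p(2) that show thesis by (auto simp: le_fun_def)
qed

section \<open>Norming functionals, first real linear, then linear over the scalar field\<close>

lemma sublinear_norm: "sublinear norm"
  by (simp add: sublinear_def norm_triangle_ineq)

text \<open>The norm is first decreased in the direction \<open>y\<close>. A linear functional below
  the decreased \<open>q\<close> must satisfy \<open>f (- y) \<le> - norm y\<close>, which is the
  attainment at \<open>y\<close>.\<close>

lemma ex_norming_real_functional:
  fixes y :: "'v::real_normed_vector"
  obtains f where "linear f" "\<And>x. f x \<le> norm x" "f y = norm y"
proof -
  obtain q where q: "sublinear q" "q \<le> norm" "q (- y) \<le> - norm y"
    using sublinear_directional_Inf[OF sublinear_norm] by blast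
  from linear_below_sublinear[OF q(1)] obtain f where f: "linear f" "\<And>x. f x \<le> q x"
    by blast
  have le: "f x \<le> norm x" for x
    using f(2)[of x] q(2) by (auto simp: le_fun_def intro: order_trans)
  have "- f y \<le> - norm y"
    using f(2)[of "- y"] q(3) linear_neg[OF f(1), of y] by simp
  with le[of y] have "f y = norm y" by simp
  with f(1) le that show thesis by blast
qed

text \<open>A real norming functional \<open>r\<close> is turned into a scalar-linear one with real
  part \<open>r\<close>. A unimodular rotation makes the value at a given point real, so the bound
  for \<open>r\<close> carries over to the modulus.\<close>

lemma (in normed_scaling) ex_norming_functional:
  obtains f :: "'v \<Rightarrow> 'k" where "\<And>x y. f (x + y) = f x + f y" "\<And>c x. f (scaleK c x) = c * f x"
    "\<And>x. norm (f x) \<le> norm x" "f v = of_real (norm v)"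
proof -
  let ?H = "scalar_embedding :: 'k \<Rightarrow> complex"
  obtain r where r: "linear r" "\<And>x. r x \<le> norm x" "r v = norm v"
    using ex_norming_real_functional by blast
  have r_real: "r (scaleK (of_real t) x) = t * r x" for t x
    using r(1) by (simp add: scale_of_real linear_cmul)
  have "\<exists>f :: 'v \<Rightarrow> 'k. (\<forall>x y. f (x + y) = f x + f y) \<and> (\<forall>c x. f (scaleK c x) = c * f x) \<and>
      (\<forall>x. scalar_Re (f x) = r x)"
    using range_scalar_embedding[where 'k = 'k]
  proof
    assume "range ?H = \<real>"
    have real: "\<exists>t. c = of_real t" for c :: 'k
      by (metis Reals_cases \<open>range ?H = \<real>\<close> rangeI scalar_embedding_eq_iff
          scalar_embedding_of_real)
    show ?thesis
    proof (intro exI[of _ "\<lambda>x. of_real (r x)"] conjI allI)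
      show "of_real (r (scaleK c x)) = c * of_real (r x)" for c x
        using real[of c] r_real by auto
    qed (simp_all add: linear_add[OF r(1)])
  next
    \<comment> \<open>Here the field has a square root \<open>j\<close> of -1, and the usual
      complexification \<open>r x - j * r (j x)\<close> works.\<close>
    assume UNIV: "range ?H = UNIV"
    then obtain j where j: "?H j = \<i>"
      by (metis UNIV_I imageE)
    have "?H (j * j) = ?H (of_real (- 1))"
      unfolding scalar_embedding_mult scalar_embedding_of_real j by simp
    then have jj: "j * j = - 1"
      unfolding scalar_embedding_eq_iff by simp
    have split: "\<exists>a b. c = of_real a + of_real b * j" for c
    proof (intro exI)
      show "c = of_real (Re (?H c)) + of_real (Im (?H c)) * j"
        unfolding scalar_embedding_eq_iff[symmetric, of c]
        by (simp add: scalar_embedding_add scalar_embedding_mult scalar_embedding_of_real j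
            complex_eq_iff)
    qed
    define f where "f x = of_real (r x) - j * of_real (r (scaleK j x))" for x
    show ?thesis
    proof (intro exI[of _ f] conjI allI)
      show "f (x + y) = f x + f y" for x y
        by (simp add: f_def linear_add[OF r(1)] scale_right_distrib algebra_simps)
      show "scalar_Re (f x) = r x" for x
        by (simp add: f_def scalar_Re_def scalar_embedding_diff scalar_embedding_mult
            scalar_embedding_of_real j)
      show "f (scaleK c x) = c * f x" for c x
      proof -
        obtain a b where c: "c = of_real a + of_real b * j"
          using split by blast
        have 1: "r (scaleK c x) = a * r x + b * r (scaleK j x)" for x
          by (simp add: c scale_left_distrib linear_add[OF r(1)] r_real flip: scale_scale)
        have "scaleK j (scaleK c x) = scaleK c (scaleK j x)"
          by (simp add: mult.commute)
        moreover have "r (scaleK j (scaleK j x)) = - r x"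
          by (simp add: jj linear_neg[OF r(1)])
        ultimately have 2: "r (scaleK j (scaleK c x)) = a * r (scaleK j x) - b * r x"
          using 1[of "scaleK j x"] by (simp add: mult.commute[of c j])
        have jj': "j * (j * z) = - z" for z
          by (simp add: jj flip: mult.assoc)
        show ?thesis
          unfolding f_def 1 2 unfolding c by (simp add: algebra_simps jj')
      qed
    qed
  qed
  then obtain f :: "'v \<Rightarrow> 'k" where f: "\<And>x y. f (x + y) = f x + f y"
    "\<And>c x. f (scaleK c x) = c * f x" "\<And>x. scalar_Re (f x) = r x"
    by blast
  have bound: "norm (f x) \<le> norm x" for x
  proof -
    obtain u where u: "norm u = 1" "u * f x = of_real (norm (f x))"
      by (rule ex_unimodular_rotation)
    have "norm (f x) = r (scaleK u x)"
      by (metis f(2,3) scalar_Re_of_real u(2))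
    with r(2)[of "scaleK u x"] u(1) show ?thesis by (simp add: norm_scale)
  qed
  \<comment> \<open>The real part of the value at \<open>v\<close> already uses up the whole bound
    on its modulus, so the imaginary part vanishes.\<close>
  have "norm (?H (f v)) \<le> norm v" and re: "Re (?H (f v)) = norm v"
    using bound[of v] f(3)[of v] r(3) by (simp_all add: norm_scalar_embedding scalar_Re_def)
  then have "(Im (?H (f v)))\<^sup>2 \<le> 0"
    using cmod_power2[of "?H (f v)"] power_mono[of "norm (?H (f v))" "norm v" 2] by simp
  with re have "?H (f v) = of_real (norm v)"
    by (simp add: complex_eq_iff)
  then have "?H (f v) = ?H (of_real (norm v))"
    by (simp only: scalar_embedding_of_real)
  then have "f v = of_real (norm v)"
    unfolding scalar_embedding_eq_iff .
  with f(1,2) bound that show thesis by blast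
qed

section \<open>Duals of normed spaces with a carrier\<close>

text \<open>These axioms pass from a space to its dual, so each lemma of the locale applies to a
  space, its dual and its bidual alike.\<close>

locale normed_kspace =
  fixes X :: "('k::real_or_complex, 'v::ab_group_add) kspace"
  assumes zero_carr: "0 \<in> carr X"
    and add_carr: "x \<in> carr X \<Longrightarrow> y \<in> carr X \<Longrightarrow> x + y \<in> carr X"
    and smul_carr: "x \<in> carr X \<Longrightarrow> smul X c x \<in> carr X"
    and smul_zero: "x \<in> carr X \<Longrightarrow> smul X 0 x = 0"
    and smul_minus_one: "x \<in> carr X \<Longrightarrow> smul X (- 1) x = - x"
    and nrm_nonneg: "x \<in> carr X \<Longrightarrow> 0 \<le> nrm X x"
    and nrm_triangle: "x \<in> carr X \<Longrightarrow> y \<in> carr X \<Longrightarrow> nrm X (x + y) \<le> nrm X x + nrm X y"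
    and nrm_smul: "x \<in> carr X \<Longrightarrow> nrm X (smul X c x) = norm c * nrm X x"
    and nrm_eq_zero: "x \<in> carr X \<Longrightarrow> nrm X x = 0 \<Longrightarrow> x = 0"

lemma dual_simps:
  "carr (dual X) = bounded_operators X scalars"
  "smul (dual X) = (\<lambda>c f x. c * f x)"
  "nrm (dual X) = (\<lambda>f. SUP x\<in>unit_ball X. norm (f x))"
  by (simp_all add: dual_def operator_space_def scalars_def space_of_def)

lemma carr_dual_iff:
  "f \<in> carr (dual X) \<longleftrightarrow> (\<forall>x. x \<notin> carr X \<longrightarrow> f x = 0) \<and>
     (\<forall>x\<in>carr X. \<forall>y\<in>carr X. f (x + y) = f x + f y) \<and>
     (\<forall>c. \<forall>x\<in>carr X. f (smul X c x) = c * f x) \<and>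
     (\<exists>C. \<forall>x\<in>carr X. norm (f x) \<le> C * nrm X x)"
  by (auto simp: dual_simps bounded_operators_def scalars_def space_of_def)

lemma dual_outside: "f \<in> carr (dual X) \<Longrightarrow> x \<notin> carr X \<Longrightarrow> f x = 0"
  by (simp add: carr_dual_iff)

lemma dual_add: "f \<in> carr (dual X) \<Longrightarrow> x \<in> carr X \<Longrightarrow> y \<in> carr X \<Longrightarrow> f (x + y) = f x + f y"
  by (simp add: carr_dual_iff)

lemma dual_smul: "f \<in> carr (dual X) \<Longrightarrow> x \<in> carr X \<Longrightarrow> f (smul X c x) = c * f x"
  by (simp add: carr_dual_iff)

context normed_kspace
begin

lemma uminus_carr: "x \<in> carr X \<Longrightarrow> - x \<in> carr X"
  by (metis smul_carr smul_minus_one)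

lemma diff_carr: "x \<in> carr X \<Longrightarrow> y \<in> carr X \<Longrightarrow> x - y \<in> carr X"
  using add_carr[of x "- y"] uminus_carr by simp

lemma nrm_uminus: "x \<in> carr X \<Longrightarrow> nrm X (- x) = nrm X x"
  using nrm_smul[of x "- 1"] smul_minus_one[of x] by simp

lemma nrm_zero: "nrm X 0 = 0"
  using nrm_smul[OF zero_carr, of 0] smul_zero[OF zero_carr] by simp

lemma nrm_minus_commute: "x \<in> carr X \<Longrightarrow> y \<in> carr X \<Longrightarrow> nrm X (x - y) = nrm X (y - x)"
  using nrm_uminus[of "x - y"] diff_carr by simp

lemma nrm_triangle_diff:
  "x \<in> carr X \<Longrightarrow> y \<in> carr X \<Longrightarrow> z \<in> carr X \<Longrightarrow> nrm X (x - z) \<le> nrm X (x - y) + nrm X (y - z)"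
  using nrm_triangle[of "x - y" "y - z"] diff_carr by simp

lemma nrm_le_add_diff: "x \<in> carr X \<Longrightarrow> y \<in> carr X \<Longrightarrow> nrm X x \<le> nrm X y + nrm X (x - y)"
  using nrm_triangle[of y "x - y"] diff_carr by simp

lemma zero_in_unit_ball: "0 \<in> unit_ball X"
  by (simp add: unit_ball_def zero_carr nrm_zero)

lemma dual_zero: "f \<in> carr (dual X) \<Longrightarrow> f 0 = 0"
  using dual_add[of f X 0 0] zero_carr by simp

lemma dual_uminus: "f \<in> carr (dual X) \<Longrightarrow> x \<in> carr X \<Longrightarrow> f (- x) = - f x"
  using dual_smul[of f X x "- 1"] smul_minus_one by simp

lemma dual_diff: "f \<in> carr (dual X) \<Longrightarrow> x \<in> carr X \<Longrightarrow> y \<in> carr X \<Longrightarrow> f (x - y) = f x - f y"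
  using dual_add[of f X x "- y"] dual_uminus uminus_carr by simp

text \<open>Makes the supremum in the dual norm a genuine upper bound. The constant \<open>C\<close>
  may be negative, hence \<open>\<bar>C\<bar>\<close>.\<close>

lemma bdd_above_dual:
  assumes "f \<in> carr (dual X)"
  shows "bdd_above ((\<lambda>x. norm (f x)) ` unit_ball X)"
proof -
  from assms obtain C where C: "\<And>x. x \<in> carr X \<Longrightarrow> norm (f x) \<le> C * nrm X x"
    unfolding carr_dual_iff by blast
  have "norm (f x) \<le> \<bar>C\<bar>" if "x \<in> unit_ball X" for x
  proof -
    from that have x: "x \<in> carr X" "nrm X x \<le> 1"
      by (auto simp: unit_ball_def)
    have "norm (f x) \<le> \<bar>C\<bar> * nrm X x"
      using C[OF x(1)] nrm_nonneg[OF x(1)] by (smt (verit) mult_right_mono)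
    also have "\<dots> \<le> \<bar>C\<bar>"
      using x(2) by (simp add: mult_left_le)
    finally show ?thesis .
  qed
  then show ?thesis
    by (intro bdd_aboveI2)
qed

lemma nrm_dual_upper: "f \<in> carr (dual X) \<Longrightarrow> x \<in> unit_ball X \<Longrightarrow> norm (f x) \<le> nrm (dual X) f"
  unfolding dual_simps(3) by (rule cSUP_upper[OF _ bdd_above_dual])

lemma nrm_dual_nonneg: "f \<in> carr (dual X) \<Longrightarrow> 0 \<le> nrm (dual X) f"
  using nrm_dual_upper[OF _ zero_in_unit_ball] norm_ge_zero order_trans by blast

lemma nrm_dual_least: "(\<And>x. x \<in> unit_ball X \<Longrightarrow> norm (f x) \<le> C) \<Longrightarrow> nrm (dual X) f \<le> C"
  unfolding dual_simps(3) using zero_in_unit_ball by (intro cSUP_least) auto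

lemma less_nrm_dualD: "c < nrm (dual X) f \<Longrightarrow> \<exists>x\<in>unit_ball X. c < norm (f x)"
  using nrm_dual_least[of f c] by (meson linorder_not_less)

lemma dual_bound:
  assumes f: "f \<in> carr (dual X)" and x: "x \<in> carr X"
  shows "norm (f x) \<le> nrm (dual X) f * nrm X x"
proof (cases "nrm X x = 0")
  case True
  then show ?thesis
    using nrm_eq_zero[OF x] dual_zero[OF f] by simp
next
  case False
  with nrm_nonneg[OF x] have pos: "0 < nrm X x" by simp
  let ?x = "smul X (of_real (1 / nrm X x)) x"
  have "?x \<in> unit_ball X"
    using pos by (simp add: unit_ball_def smul_carr x nrm_smul del: of_real_divide)
  from nrm_dual_upper[OF f this] pos show ?thesis
    by (simp add: dual_smul[OF f x] norm_mult norm_divide field_simps)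
qed

lemma dual_normed_kspace: "normed_kspace (dual X)"
proof
  show "0 \<in> carr (dual X)"
    by (auto simp: carr_dual_iff zero_fun_def intro: exI[of _ 0])
next
  fix f g assume f: "f \<in> carr (dual X)" and g: "g \<in> carr (dual X)"
  have "norm ((f + g) x) \<le> (nrm (dual X) f + nrm (dual X) g) * nrm X x" if "x \<in> carr X" for x
    using dual_bound[OF f that] dual_bound[OF g that] norm_triangle_ineq[of "f x" "g x"]
    by (simp add: plus_fun_def distrib_right)
  then have "\<exists>C. \<forall>x\<in>carr X. norm ((f + g) x) \<le> C * nrm X x"
    by blast
  with f g show "f + g \<in> carr (dual X)"
    unfolding carr_dual_iff by (simp add: plus_fun_def algebra_simps)
  show "nrm (dual X) (f + g) \<le> nrm (dual X) f + nrm (dual X) g"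
  proof (rule nrm_dual_least)
    fix x assume "x \<in> unit_ball X"
    then show "norm ((f + g) x) \<le> nrm (dual X) f + nrm (dual X) g"
      using nrm_dual_upper[OF f] nrm_dual_upper[OF g] norm_triangle_ineq[of "f x" "g x"]
      by (smt (verit) plus_fun_def)
  qed
next
  fix f c assume f: "f \<in> carr (dual X)"
  have "norm (c * f x) \<le> (norm c * nrm (dual X) f) * nrm X x" if "x \<in> carr X" for x
    using mult_left_mono[OF dual_bound[OF f that] norm_ge_zero[of c]]
    by (simp add: norm_mult mult.assoc)
  then have "\<exists>C. \<forall>x\<in>carr X. norm (c * f x) \<le> C * nrm X x"
    by blast
  with f show cf: "smul (dual X) c f \<in> carr (dual X)"
    unfolding dual_simps(2) carr_dual_iff by (simp add: algebra_simps)
  show "smul (dual X) 0 f = 0" "smul (dual X) (- 1) f = - f"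
    by (auto simp: dual_simps zero_fun_def fun_Compl_def)
  show "0 \<le> nrm (dual X) f"
    by (rule nrm_dual_nonneg[OF f])
  show "nrm (dual X) (smul (dual X) c f) = norm c * nrm (dual X) f"
  proof (rule antisym)
    show "nrm (dual X) (smul (dual X) c f) \<le> norm c * nrm (dual X) f"
      using nrm_dual_upper[OF f]
      by (intro nrm_dual_least) (simp add: dual_simps norm_mult mult_left_mono)
    show "norm c * nrm (dual X) f \<le> nrm (dual X) (smul (dual X) c f)"
    proof (cases "c = 0")
      case True
      then show ?thesis
        using nrm_dual_nonneg[OF cf] by simp
    next
      case False
      have "nrm (dual X) f \<le> nrm (dual X) (smul (dual X) c f) / norm c"
        using nrm_dual_upper[OF cf] False
        by (intro nrm_dual_least) (simp add: dual_simps norm_mult field_simps)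
      with False show ?thesis by (simp add: field_simps)
    qed
  qed
  assume "nrm (dual X) f = 0"
  with dual_bound[OF f] have "f x = 0" if "x \<in> carr X" for x
    using that by force
  with dual_outside[OF f] show "f = 0"
    by (force simp: zero_fun_def)
qed

section \<open>Norm topology, weak-star topology and weak-star compactness\<close>

lemma Metric_space_nrm:
  "Metric_space (carr X) (\<lambda>x y. if x \<in> carr X \<and> y \<in> carr X then nrm X (x - y) else 0)"
proof
  fix x y z assume "x \<in> carr X" "y \<in> carr X"
  then show "(if x \<in> carr X \<and> y \<in> carr X then nrm X (x - y) else 0) = 0 \<longleftrightarrow> x = y"
    using nrm_eq_zero[of "x - y"] diff_carr[of x y] nrm_zero by auto
  assume "z \<in> carr X"
  with \<open>x \<in> carr X\<close> \<open>y \<in> carr X\<close>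
  show "(if x \<in> carr X \<and> z \<in> carr X then nrm X (x - z) else 0)
    \<le> (if x \<in> carr X \<and> y \<in> carr X then nrm X (x - y) else 0)
      + (if y \<in> carr X \<and> z \<in> carr X then nrm X (y - z) else 0)"
    using nrm_triangle_diff by simp
qed (auto simp: nrm_minus_commute nrm_nonneg diff_carr)

lemma norm_closure_of_iff:
  "z \<in> norm_topology X closure_of S \<longleftrightarrow>
    z \<in> carr X \<and> (\<forall>r>0. \<exists>y\<in>S. y \<in> carr X \<and> nrm X (z - y) < r)"
proof -
  interpret M: Metric_space "carr X" "\<lambda>x y. if x \<in> carr X \<and> y \<in> carr X then nrm X (x - y) else 0"
    by (rule Metric_space_nrm)
  show ?thesis
    unfolding norm_topology_def M.metric_closure_of by (auto simp: M.in_mball)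
qed

lemma separable_norm_topologyD:
  assumes "separable_space (norm_topology X)"
  shows "\<exists>D. countable D \<and> D \<subseteq> carr X \<and> (\<forall>x\<in>carr X. \<forall>r>0. \<exists>y\<in>D. nrm X (x - y) < r)"
proof -
  interpret M: Metric_space "carr X" "\<lambda>x y. if x \<in> carr X \<and> y \<in> carr X then nrm X (x - y) else 0"
    by (rule Metric_space_nrm)
  have "topspace (norm_topology X) = carr X"
    unfolding norm_topology_def by simp
  with assms obtain D where D: "countable D" "D \<subseteq> carr X" "norm_topology X closure_of D = carr X"
    by (auto simp: separable_space_def)
  from D(3) have "\<exists>y\<in>D. nrm X (x - y) < r" if "x \<in> carr X" "0 < r" for x r
    using that norm_closure_of_iff[of x D] by blast
  with D(1,2) show ?thesis
    by (intro exI[of _ D]) simp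
qed

text \<open>Induction on how the open set is generated: for an intersection the finite sets are
  united and the smaller radius is kept, and a subbasic set needs one point only.\<close>

lemma weak_star_nhd:
  assumes "openin (weak_star_topology X) U" "u \<in> U"
  shows "\<exists>F e. finite F \<and> F \<subseteq> carr X \<and> 0 < e \<and>
    (\<forall>v\<in>carr (dual X). (\<forall>z\<in>F. norm (v z - u z) < e) \<longrightarrow> v \<in> U)"
proof -
  from assms(1) have "generate_topology_on
      {{u \<in> carr (dual X). u z \<in> U} | z U. z \<in> carr X \<and> open U} U"
    unfolding weak_star_topology_def by (rule openin_topology_generated_by)
  then show ?thesis
    using assms(2)
  proof induction
    case Empty
    then show ?case by simp
  next
    case (Int a b)
    from Int.IH(1) Int.prems obtain F e where
      "finite F" "F \<subseteq> carr X" "0 < e" "\<forall>v\<in>carr (dual X). (\<forall>z\<in>F. norm (v z - u z) < e) \<longrightarrow> v \<in> a"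
      by blast
    moreover from Int.IH(2) Int.prems obtain G d where
      "finite G" "G \<subseteq> carr X" "0 < d" "\<forall>v\<in>carr (dual X). (\<forall>z\<in>G. norm (v z - u z) < d) \<longrightarrow> v \<in> b"
      by blast
    ultimately show ?case
      by (intro exI[of _ "F \<union> G"] exI[of _ "min d e"]) auto
  next
    case (UN K)
    then obtain k where k: "k \<in> K" "u \<in> k"
      by blast
    from UN.IH[OF this] k(1) show ?case
      by (meson UnionI)
  next
    case (Basis s)
    then obtain z V where s: "s = {u \<in> carr (dual X). u z \<in> V}" and z: "z \<in> carr X" "open V"
      by blast
    with Basis obtain e where "0 < e" "\<forall>y. dist y (u z) < e \<longrightarrow> y \<in> V"
      by (auto simp: open_dist)
    with s z show ?case
      by (intro exI[of _ "{z}"] exI[of _ e]) (auto simp: dist_norm)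
  qed
qed

lemma in_weak_star_closure_ofI:
  assumes u: "u \<in> carr (dual X)" and S: "S \<subseteq> carr (dual X)"
    and approx: "\<And>F e. finite F \<Longrightarrow> F \<subseteq> carr X \<Longrightarrow> 0 < e \<Longrightarrow> \<exists>v\<in>S. \<forall>z\<in>F. norm (v z - u z) < e"
  shows "u \<in> weak_star_topology X closure_of S"
  unfolding in_closure_of
proof (intro conjI allI impI)
  \<comment> \<open>Evaluation at 0 with the condition \<open>UNIV\<close> shows that the whole dual
    is open, hence contained in the topological space.\<close>
  have "openin (weak_star_topology X) {u \<in> carr (dual X). u 0 \<in> UNIV}"
    unfolding weak_star_topology_def using zero_carr
    by (intro topology_generated_by_Basis) blast
  then show "u \<in> topspace (weak_star_topology X)"
    using openin_subset u by blast
  fix U assume "u \<in> U \<and> openin (weak_star_topology X) U"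
  with weak_star_nhd[of U u] obtain F e where F: "finite F" "F \<subseteq> carr X" "0 < e"
    "\<forall>v\<in>carr (dual X). (\<forall>z\<in>F. norm (v z - u z) < e) \<longrightarrow> v \<in> U"
    by blast
  from approx[OF F(1-3)] obtain v where "v \<in> S" "\<forall>z\<in>F. norm (v z - u z) < e"
    by blast
  with F(4) S show "\<exists>y. y \<in> S \<and> y \<in> U"
    by blast
qed

text \<open>The Banach-Alaoglu argument for a sequence. The functionals lie in a product of compact
  scalar balls; compactness applied to the filter of tails yields a point that finitely many
  coordinates approach infinitely often. Linearity and the norm bound pass to it
  coordinatewise.\<close>

lemma dual_sequence_cluster_point:
  fixes v :: "nat \<Rightarrow> 'v \<Rightarrow> 'k"
  assumes v: "\<And>n. v n \<in> carr (dual X)" "\<And>n. nrm (dual X) (v n) \<le> 1"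
  obtains u where "u \<in> carr (dual X)" "nrm (dual X) u \<le> 1"
    "\<And>F e N. finite F \<Longrightarrow> 0 < e \<Longrightarrow> \<exists>n\<ge>N. \<forall>z\<in>F. norm (v n z - u z) < e"
proof -
  \<comment> \<open>Radius 0 off the carrier forces the cluster point to vanish there, as membership
    in the dual requires.\<close>
  define S where "S z = (cball 0 (if z \<in> carr X then nrm X z else 0) :: 'k set)" for z
  have "compactin (product_topology (\<lambda>z. euclidean) UNIV) (Pi\<^sub>E UNIV S)"
    unfolding compactin_PiE S_def by (simp add: compact_cball_scalar)
  then have "compact (Pi\<^sub>E UNIV S)"
    by (simp add: euclidean_product_topology)
  moreover have "v n \<in> Pi\<^sub>E UNIV S" for n
  proof -
    have "norm (v n z) \<le> nrm X z" if "z \<in> carr X" for z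
      using dual_bound[OF v(1) that, of n] mult_right_mono[OF v(2)[of n] nrm_nonneg[OF that]]
      by simp
    then show ?thesis
      using dual_outside[OF v(1)] by (auto simp: S_def)
  qed
  moreover have "filtermap v sequentially \<noteq> bot"
    by (simp add: filtermap_bot_iff)
  ultimately obtain u where u: "u \<in> Pi\<^sub>E UNIV S" "inf (nhds u) (filtermap v sequentially) \<noteq> bot"
    unfolding compact_filter by (metis (mono_tags, lifting) always_eventually eventually_filtermap)
  have cluster: "\<exists>n\<ge>N. \<forall>z\<in>F. norm (v n z - u z) < e" if F: "finite F" "0 < e" for F e N
  proof (rule ccontr)
    assume *: "\<not> ?thesis"
    let ?W = "\<Inter>z\<in>F. {g. norm (g z - u z) < e}"
    have "open ?W"
      using F(1)
      by (intro open_INT ballI open_Collect_less continuous_intros continuous_on_product_coordinates) auto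
    with F(2) have "eventually (\<lambda>g. g \<in> ?W) (nhds u)"
      by (intro eventually_nhds_in_open) auto
    moreover from * have "eventually (\<lambda>g. g \<notin> ?W) (filtermap v sequentially)"
      unfolding eventually_filtermap by (auto intro!: eventually_sequentiallyI[of N])
    ultimately have "eventually (\<lambda>g. False) (inf (nhds u) (filtermap v sequentially))"
      unfolding eventually_inf by blast
    with u(2) show False
      by (simp add: trivial_limit_def)
  qed
  have bound: "norm (u z) \<le> nrm X z" if "z \<in> carr X" for z
    using u(1) that by (auto simp: S_def PiE_iff split: if_splits dest: spec[of _ z])
  have "u \<in> carr (dual X)"
    unfolding carr_dual_iff
  proof (intro conjI allI ballI impI)
    fix x assume "x \<notin> carr X"
    then show "u x = 0"
      using u(1) by (auto simp: S_def PiE_iff split: if_splits dest: spec[of _ x])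
  next
    fix x y assume xy: "x \<in> carr X" "y \<in> carr X"
    have "norm (u (x + y) - (u x + u y)) \<le> e" if "0 < e" for e
    proof -
      obtain n where n: "\<forall>z\<in>{x, y, x + y}. norm (v n z - u z) < e / 3"
        using cluster[of "{x, y, x + y}" "e / 3" 0] \<open>0 < e\<close> by auto
      have "u (x + y) - (u x + u y)
          = (v n x - u x) + (v n y - u y) - (v n (x + y) - u (x + y))"
        by (simp add: dual_add[OF v(1) xy])
      also have "norm \<dots> \<le> norm (v n x - u x) + norm (v n y - u y) + norm (v n (x + y) - u (x + y))"
        using norm_triangle_ineq[of "v n x - u x" "v n y - u y"]
          norm_triangle_ineq4[of "(v n x - u x) + (v n y - u y)" "v n (x + y) - u (x + y)"]
        by linarith
      finally show ?thesis using n by simp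
    qed
    then have "norm (u (x + y) - (u x + u y)) \<le> 0"
      by (rule field_le_epsilon[of _ 0, simplified])
    then show "u (x + y) = u x + u y" by simp
  next
    fix c x assume x: "x \<in> carr X"
    have "norm (u (smul X c x) - c * u x) \<le> e" if "0 < e" for e
    proof -
      \<comment> \<open>Chosen so that the error \<open>d\<close> at \<open>smul X c x\<close> and
        the error \<open>norm c * d\<close> from \<open>x\<close> add up to
        \<open>e\<close>.\<close>
      define d where "d = e / (1 + norm c)"
      have d: "0 < d" "d + norm c * d = e"
        using \<open>0 < e\<close> add_pos_nonneg[OF zero_less_one norm_ge_zero[of c]]
        by (simp_all add: d_def divide_simps) (simp add: algebra_simps)
      obtain n where n: "\<forall>z\<in>{x, smul X c x}. norm (v n z - u z) < d"
        using cluster[of "{x, smul X c x}" d 0] d(1) by auto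
      have "u (smul X c x) - c * u x = c * (v n x - u x) - (v n (smul X c x) - u (smul X c x))"
        by (simp add: dual_smul[OF v(1) x] algebra_simps)
      also have "norm \<dots> \<le> norm c * norm (v n x - u x) + norm (v n (smul X c x) - u (smul X c x))"
        using norm_triangle_ineq4[of "c * (v n x - u x)" "v n (smul X c x) - u (smul X c x)"]
        by (simp add: norm_mult)
      also have "\<dots> \<le> norm c * d + d"
        using n by (intro add_mono mult_left_mono) auto
      finally show ?thesis using d(2) by simp
    qed
    then have "norm (u (smul X c x) - c * u x) \<le> 0"
      by (rule field_le_epsilon[of _ 0, simplified])
    then show "u (smul X c x) = c * u x" by simp
  next
    show "\<exists>C. \<forall>x\<in>carr X. norm (u x) \<le> C * nrm X x"
      using bound by (intro exI[of _ 1]) simp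
  qed
  moreover have "nrm (dual X) u \<le> 1"
    using bound by (intro nrm_dual_least) (auto simp: unit_ball_def intro: order_trans)
  ultimately show thesis
    using that cluster by blast
qed

end

lemma sum_fun_apply: "(\<Sum>i\<in>A. h i) x = (\<Sum>i\<in>A. h i x)"
  for h :: "'i \<Rightarrow> 'a \<Rightarrow> 'b::comm_monoid_add"
  by (induction A rule: infinite_finite_induct) (simp_all add: plus_fun_def zero_fun_def)

context normed_kspace
begin

lemma sum_carr: "(\<And>i. i \<in> A \<Longrightarrow> x i \<in> carr X) \<Longrightarrow> (\<Sum>i\<in>A. x i) \<in> carr X"
  by (induction A rule: infinite_finite_induct) (auto intro: add_carr zero_carr)

lemma dual_sum:
  assumes "f \<in> carr (dual X)" "\<And>i. i \<in> A \<Longrightarrow> x i \<in> carr X"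
  shows "f (\<Sum>i\<in>A. x i) = (\<Sum>i\<in>A. f (x i))"
  using assms(2)
  by (induction A rule: infinite_finite_induct)
    (auto simp: dual_zero[OF assms(1)] dual_add[OF assms(1)] sum_carr)

end

section \<open>The given space, its dual and bidual, and the canonical embedding\<close>

lemma (in normed_scaling) normed_kspace_space_of: "normed_kspace (space_of scaleK)"
  by standard (simp_all add: space_of_def norm_scale norm_triangle_ineq)

context normed_scaling
begin

abbreviation Y :: "('k, 'v) kspace" where "Y \<equiv> space_of scaleK"

abbreviation J :: "'v \<Rightarrow> ('v \<Rightarrow> 'k) \<Rightarrow> 'k" where "J \<equiv> canonical_embedding Y"

end

sublocale normed_scaling \<subseteq> Y: normed_kspace Y
  by (rule normed_kspace_space_of)

sublocale normed_scaling \<subseteq> Y': normed_kspace "dual Y"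
  by (rule Y.dual_normed_kspace)

sublocale normed_scaling \<subseteq> Y'': normed_kspace "dual (dual Y)"
  by (rule Y'.dual_normed_kspace)

context normed_scaling
begin

lemma space_of_simps: "carr Y = UNIV" "smul Y = scaleK" "nrm Y = norm"
  by (simp_all add: space_of_def)

lemma unit_ball_Y: "unit_ball Y = cball 0 1"
  by (auto simp: unit_ball_def space_of_simps)

lemma
  assumes "f \<in> carr (dual Y)"
  shows functional_add: "f (x + y) = f x + f y"
    and functional_diff: "f (x - y) = f x - f y"
    and functional_scale: "f (scaleK c x) = c * f x"
    and functional_bound: "norm (f x) \<le> nrm (dual Y) f * norm x"
  using dual_add[OF assms, of x y] Y.dual_diff[OF assms, of x y] dual_smul[OF assms, of x c]
    Y.dual_bound[OF assms, of x]
  by (simp_all add: space_of_simps)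

lemma ex_norming_in_dual:
  obtains f where "f \<in> carr (dual Y)" "nrm (dual Y) f \<le> 1" "f v = of_real (norm v)"
proof -
  obtain f :: "'v \<Rightarrow> 'k" where f: "\<And>x y. f (x + y) = f x + f y" "\<And>c x. f (scaleK c x) = c * f x"
    "\<And>x. norm (f x) \<le> norm x" "f v = of_real (norm v)"
    using ex_norming_functional[of v] by blast
  have "f \<in> carr (dual Y)"
    unfolding carr_dual_iff space_of_simps using f(1-3) by (auto intro: exI[of _ 1])
  moreover have "nrm (dual Y) f \<le> 1"
    by (rule Y.nrm_dual_least) (use f(3) in \<open>auto simp: unit_ball_Y intro: order_trans\<close>)
  ultimately show thesis
    using f(4) that by blast
qed

lemma J_apply: "f \<in> carr (dual Y) \<Longrightarrow> J y f = f y"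
  by (simp add: canonical_embedding_def)

lemma J_in_bidual: "J y \<in> carr (dual (dual Y))"
  unfolding carr_dual_iff[of _ "dual Y"]
proof (intro conjI allI ballI impI)
  show "J y f = 0" if "f \<notin> carr (dual Y)" for f
    using that by (simp add: canonical_embedding_def)
  show "J y (f + g) = J y f + J y g" if "f \<in> carr (dual Y)" "g \<in> carr (dual Y)" for f g
    using that Y'.add_carr[OF that] by (simp add: J_apply plus_fun_def)
  show "J y (smul (dual Y) c f) = c * J y f" if "f \<in> carr (dual Y)" for c f
    using that Y'.smul_carr[OF that, of c] by (simp add: J_apply dual_simps(2))
  show "\<exists>C. \<forall>f\<in>carr (dual Y). norm (J y f) \<le> C * nrm (dual Y) f"
    by (rule exI[of _ "norm y"]) (simp add: J_apply functional_bound mult.commute[of "norm y"])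
qed

text \<open>The lower bound is the Hahn-Banach theorem: \<open>J y\<close> is tested on a functional
  that norms \<open>y\<close>.\<close>

lemma nrm_J: "nrm (dual (dual Y)) (J y) = norm y"
proof (rule antisym)
  show "nrm (dual (dual Y)) (J y) \<le> norm y"
  proof (rule Y'.nrm_dual_least)
    fix f assume "f \<in> unit_ball (dual Y)"
    then have f: "f \<in> carr (dual Y)" "nrm (dual Y) f \<le> 1"
      by (auto simp: unit_ball_def)
    then show "norm (J y f) \<le> norm y"
      using functional_bound[OF f(1), of y] mult_right_mono[OF f(2) norm_ge_zero[of y]]
      by (simp add: J_apply)
  qed
  obtain f where f: "f \<in> carr (dual Y)" "nrm (dual Y) f \<le> 1" "f y = of_real (norm y)"
    by (rule ex_norming_in_dual)
  then show "norm y \<le> nrm (dual (dual Y)) (J y)"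
    using Y'.nrm_dual_upper[OF J_in_bidual, of f y] by (simp add: J_apply unit_ball_def)
qed

lemma J_diff: "J (x - y) = J x - J y"
  by (auto simp: canonical_embedding_def functional_diff)

lemma J_add: "J (x + y) = J x + J y"
  by (auto simp: canonical_embedding_def functional_add)

lemma J_scale: "J (scaleK c x) = smul (dual (dual Y)) c (J x)"
  by (auto simp: canonical_embedding_def functional_scale dual_simps(2))


section \<open>Approximation of bidual elements\<close>

text \<open>If \<open>y\<close> nearly minimizes \<open>\<Sum>f\<in>F. \<bar>\<phi> f - f y\<bar>\<^sup>2\<close> over the unit ball and the infimum is
  \<open>\<delta> > 0\<close>, then the functional \<open>g = \<Sum>f\<in>F. cnj (\<phi> f - f y) f\<close>, the gradient at \<open>y\<close>, nearly
  attains its norm at \<open>y\<close>, while \<open>\<bar>\<phi> g\<bar>\<close> exceeds \<open>Re (g y)\<close> by \<open>\<delta>\<close>.\<close>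

lemma Goldstine:
  assumes \<phi>: "\<phi> \<in> carr (dual (dual Y))" "nrm (dual (dual Y)) \<phi> \<le> 1"
    and F: "finite F" "F \<subseteq> carr (dual Y)" and e: "0 < e"
  shows "\<exists>y. norm y \<le> 1 \<and> (\<forall>f\<in>F. norm (f y - \<phi> f) < e)"
proof (rule ccontr)
  assume no: "\<not> ?thesis"
  define D where "D y = (\<Sum>f\<in>F. (norm (\<phi> f - f y))\<^sup>2)" for y
  \<comment> \<open>If approximation fails at every point of the ball, some summand of
    \<open>D\<close> is at least \<open>e\<^sup>2\<close> there, so the infimum is positive.\<close>
  have D_ge: "e\<^sup>2 \<le> D y" if "norm y \<le> 1" for y
  proof -
    from no that obtain f where f: "f \<in> F" "e \<le> norm (f y - \<phi> f)"
      by (meson linorder_not_less)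
    then have "e\<^sup>2 \<le> (norm (\<phi> f - f y))\<^sup>2"
      using e by (intro power_mono) (auto simp: norm_minus_commute)
    also have "\<dots> \<le> D y"
      unfolding D_def by (rule member_le_sum[OF f(1)]) (use F in auto)
    finally show ?thesis .
  qed
  define \<delta> where "\<delta> = (INF y\<in>cball 0 1. D y)"
  have \<delta>_le: "\<delta> \<le> D y" if "norm y \<le> 1" for y
    unfolding \<delta>_def by (rule cINF_lower) (use that D_ge in \<open>auto intro!: bdd_belowI2\<close>)
  have "e\<^sup>2 \<le> \<delta>"
    unfolding \<delta>_def by (rule cINF_greatest) (use D_ge in auto)
  moreover have "0 < e\<^sup>2"
    using e by simp
  ultimately have \<delta>: "0 < \<delta>"
    by linarith
  \<comment> \<open>Bounds the quadratic coefficient of \<open>D\<close> along every segment in the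
    ball; the summand 1 keeps it positive for the division below.\<close>
  define M where "M = 1 + (\<Sum>f\<in>F. (2 * nrm (dual Y) f)\<^sup>2)"
  have M: "0 < M"
    unfolding M_def by (intro add_pos_nonneg sum_nonneg) auto
  have M_ge: "(\<Sum>f\<in>F. (norm (f x - f y))\<^sup>2) \<le> M" if "norm x \<le> 1" "norm y \<le> 1" for x y
  proof -
    have "norm (f x - f y) \<le> 2 * nrm (dual Y) f" if "f \<in> F" for f
    proof -
      have f: "f \<in> carr (dual Y)"
        using F(2) that by blast
      have "norm (f x) \<le> nrm (dual Y) f" "norm (f y) \<le> nrm (dual Y) f"
        using Y.nrm_dual_upper[OF f, of x] Y.nrm_dual_upper[OF f, of y] \<open>norm x \<le> 1\<close> \<open>norm y \<le> 1\<close>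
        by (simp_all add: unit_ball_Y)
      with norm_triangle_ineq4[of "f x" "f y"] show ?thesis by linarith
    qed
    then have "(\<Sum>f\<in>F. (norm (f x - f y))\<^sup>2) \<le> (\<Sum>f\<in>F. (2 * nrm (dual Y) f)\<^sup>2)"
      by (intro sum_mono power_mono) auto
    then show ?thesis by (simp add: M_def)
  qed
  \<comment> \<open>The step length: at most 1, so that moving from \<open>y\<close> towards
    \<open>x\<close> stays in the ball, and small enough that the quadratic term is at most
    \<open>t * \<delta> / 2\<close>.\<close>
  define t where "t = min 1 (\<delta> / (2 * M))"
  have t: "0 < t" "t \<le> 1" "t * M \<le> \<delta> / 2"
    using \<delta> M by (auto simp: t_def min_def field_simps)
  \<comment> \<open>The slack is proportional to \<open>t\<close>, so it survives division by
    \<open>t\<close> as \<open>\<delta> / 2\<close>.\<close>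
  obtain y where y: "norm y \<le> 1" "D y < \<delta> + t * \<delta> / 2"
  proof -
    have "\<exists>y\<in>cball 0 1. D y < \<delta> + t * \<delta> / 2"
    proof (rule ccontr)
      assume "\<not> ?thesis"
      then have "\<delta> + t * \<delta> / 2 \<le> (INF y\<in>cball 0 1. D y)"
        by (intro cINF_greatest) (auto simp: not_less)
      then have "\<delta> + t * \<delta> / 2 \<le> \<delta>"
        by (simp only: \<delta>_def)
      moreover have "0 < t * \<delta>"
        using t(1) \<delta> by simp
      ultimately show False by simp
    qed
    with that show thesis by auto
  qed
  define v where "v f = \<phi> f - f y" for f
  define g where "g = (\<Sum>f\<in>F. smul (dual Y) (scalar_cnj (v f)) f)"
  have g_apply: "g x = (\<Sum>f\<in>F. scalar_cnj (v f) * f x)" for x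
    by (simp add: g_def sum_fun_apply dual_simps(2))
  have g: "g \<in> carr (dual Y)"
    unfolding g_def using F(2) by (intro Y'.sum_carr Y'.smul_carr) auto
  \<comment> \<open>First-order condition at the near-minimizer: a larger increase of the real part
    of \<open>g\<close> towards \<open>x\<close> would push \<open>D\<close> below its infimum at
    the point \<open>z\<close> of the segment.\<close>
  have key: "scalar_Re (g x) \<le> scalar_Re (g y) + \<delta> / 2" if x: "norm x \<le> 1" for x
  proof -
    let ?G = "scalar_Re (g x) - scalar_Re (g y)"
    define z where "z = y + scaleK (of_real t) (x - y)"
    have "z = (1 - t) *\<^sub>R y + t *\<^sub>R x"
      by (simp add: z_def scale_of_real algebra_simps)
    moreover have "norm ((1 - t) *\<^sub>R y + t *\<^sub>R x) \<le> (1 - t) * 1 + t * 1"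
      using x y(1) t by (intro norm_triangle_le add_mono) (auto intro!: mult_left_mono mult_left_le)
    ultimately have "norm z \<le> 1"
      by simp
    then have "\<delta> \<le> D z"
      by (rule \<delta>_le)
    also have "D z = (\<Sum>f\<in>F. (norm (v f - of_real t * (f x - f y)))\<^sup>2)"
      unfolding D_def
    proof (rule sum.cong[OF refl])
      fix f assume "f \<in> F"
      with F(2) have f: "f \<in> carr (dual Y)" by blast
      have "f z = f y + of_real t * (f x - f y)"
        unfolding z_def functional_add[OF f] functional_scale[OF f] functional_diff[OF f] ..
      then have "\<phi> f - f z = v f - of_real t * (f x - f y)"
        by (simp add: v_def)
      then show "(norm (\<phi> f - f z))\<^sup>2 = (norm (v f - of_real t * (f x - f y)))\<^sup>2"
        by simp
    qed
    also have "\<dots> = D y - 2 * t * ?G + t\<^sup>2 * (\<Sum>f\<in>F. (norm (f x - f y))\<^sup>2)"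
    proof -
      have "?G = (\<Sum>f\<in>F. scalar_Re (scalar_cnj (v f) * (f x - f y)))"
        by (simp add: g_apply scalar_Re_sum scalar_Re_diff right_diff_distrib sum_subtractf)
      then show ?thesis
        unfolding norm_diff_power2_scalar
        by (simp add: D_def v_def sum.distrib sum_subtractf sum_distrib_left mult.assoc)
    qed
    also have "\<dots> \<le> D y - 2 * t * ?G + t\<^sup>2 * M"
      using M_ge[OF x y(1)] by (intro add_left_mono mult_left_mono) auto
    finally have "2 * t * ?G \<le> D y - \<delta> + t * (t * M)"
      by (simp add: power2_eq_square algebra_simps)
    also have "\<dots> \<le> t * \<delta> / 2 + t * (\<delta> / 2)"
      using y(2) t by (intro add_mono mult_left_mono) auto
    finally have "t * (2 * ?G) \<le> t * \<delta>"
      by (simp add: algebra_simps)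
    with t(1) show ?thesis by simp
  qed
  have nrm_g: "nrm (dual Y) g \<le> scalar_Re (g y) + \<delta> / 2"
  proof (rule Y.nrm_dual_least)
    fix x assume x: "x \<in> unit_ball Y"
    obtain u where u: "norm u = 1" "u * g x = of_real (norm (g x))"
      by (rule ex_unimodular_rotation)
    have "norm (g x) = scalar_Re (g (scaleK u x))"
      by (simp add: functional_scale[OF g] u(2))
    also have "\<dots> \<le> scalar_Re (g y) + \<delta> / 2"
      using x u(1) by (intro key) (simp add: unit_ball_Y norm_scale)
    finally show "norm (g x) \<le> scalar_Re (g y) + \<delta> / 2" .
  qed
  have "\<phi> g = (\<Sum>f\<in>F. scalar_cnj (v f) * \<phi> f)"
    unfolding g_def using F(2)
    by (subst Y'.dual_sum[OF \<phi>(1)]) (auto intro!: sum.cong Y'.smul_carr dual_smul[OF \<phi>(1)])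
  also have "\<dots> = g y + (\<Sum>f\<in>F. scalar_cnj (v f) * v f)"
    by (simp add: g_apply v_def sum.distrib[symmetric] algebra_simps)
  finally have "scalar_Re (\<phi> g) = scalar_Re (g y) + D y"
    by (simp add: scalar_Re_add scalar_Re_sum scalar_Re_cnj_mult_self D_def v_def)
  moreover have "scalar_Re (\<phi> g) \<le> nrm (dual Y) g"
  proof -
    have "scalar_Re (\<phi> g) \<le> norm (\<phi> g)"
      by (rule scalar_Re_le_norm)
    also have "\<dots> \<le> nrm (dual (dual Y)) \<phi> * nrm (dual Y) g"
      by (rule Y'.dual_bound[OF \<phi>(1) g])
    also have "\<dots> \<le> 1 * nrm (dual Y) g"
      using \<phi>(2) Y.nrm_dual_nonneg[OF g] by (rule mult_right_mono)
    finally show ?thesis by simp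
  qed
  \<comment> \<open>The real part of \<open>\<phi> g\<close> exceeds that of \<open>g y\<close> by
    \<open>D y \<ge> \<delta>\<close>, whereas the norm of \<open>g\<close> allows an excess of only
    \<open>\<delta> / 2\<close>.\<close>
  ultimately show False
    using nrm_g \<delta>_le[OF y(1)] \<delta> by linarith
qed


section \<open>Determining sequences of functionals\<close>

text \<open>The countable information about \<open>\<phi>\<close> on which the operator argument
  runs. Countability lets Goldstine's theorem produce a sequence of approximants.\<close>

definition determining :: "(('v \<Rightarrow> 'k) \<Rightarrow> 'k) \<Rightarrow> (nat \<Rightarrow> 'v \<Rightarrow> 'k) \<Rightarrow> bool" where
  "determining \<phi> f \<longleftrightarrow> (\<forall>i. f i \<in> carr (dual Y)) \<and>
     (\<forall>c<1. \<exists>i. nrm (dual Y) (f i) \<le> 1 \<and> c < norm (\<phi> (f i))) \<and>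
     (\<forall>w. \<exists>i. f i w \<noteq> \<phi> (f i)) \<and> (\<forall>w. (\<forall>i. f i w = 0) \<longrightarrow> w = 0)"

text \<open>A sequence in the dual unit ball on which \<open>\<phi>\<close> nearly attains its norm
  is adjoined to \<open>A\<close>, and the union is enumerated.\<close>

lemma ex_determiningI:
  assumes \<phi>: "\<phi> \<in> carr (dual (dual Y))" "nrm (dual (dual Y)) \<phi> = 1"
    and A: "countable A" "A \<subseteq> carr (dual Y)"
    and proper: "\<And>w. \<exists>f\<in>A. f w \<noteq> \<phi> f"
    and total: "\<And>w. (\<And>f. f \<in> A \<Longrightarrow> f w = 0) \<Longrightarrow> w = 0"
  shows "\<exists>f. determining \<phi> f"
proof -
  have "\<exists>g\<in>unit_ball (dual Y). 1 - 1 / real (Suc n) < norm (\<phi> g)" for n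
    by (rule Y'.less_nrm_dualD) (simp add: \<phi>(2))
  then obtain g where g: "\<And>n. g n \<in> unit_ball (dual Y)"
    "\<And>n. 1 - 1 / real (Suc n) < norm (\<phi> (g n))"
    by metis
  let ?B = "A \<union> range g"
  have "?B \<noteq> {}" "countable ?B"
    using A(1) by auto
  then obtain f :: "nat \<Rightarrow> 'v \<Rightarrow> 'k" where f: "range f = ?B"
    by (metis range_from_nat_into)
  have onto: "\<exists>i. f i = h" if "h \<in> ?B" for h
    using that unfolding f[symmetric] by blast
  have "determining \<phi> f"
    unfolding determining_def
  proof (intro conjI allI impI)
    fix i
    have "f i \<in> ?B"
      using f by blast
    with A(2) g(1) show "f i \<in> carr (dual Y)"
      by (auto simp: unit_ball_def)
  next
    fix c :: real assume "c < 1"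
    then obtain n where "1 / real (Suc n) < 1 - c"
      using nat_approx_posE[of "1 - c"] by auto
    moreover obtain i where "f i = g n"
      using onto[of "g n"] by blast
    ultimately show "\<exists>i. nrm (dual Y) (f i) \<le> 1 \<and> c < norm (\<phi> (f i))"
      using g(1)[of n] g(2)[of n] by (intro exI[of _ i]) (simp add: unit_ball_def)
  next
    fix w
    from proper[of w] onto show "\<exists>i. f i w \<noteq> \<phi> (f i)"
      by (metis UnI1)
  next
    fix w assume "\<forall>i. f i w = 0"
    then show "w = 0"
      using onto by (intro total) (metis UnI1)
  qed
  then show ?thesis by blast
qed

text \<open>Each point \<open>d\<close> of a countable dense set contributes two functionals:
  \<open>h d\<close> sees more than half of the distance from \<open>\<phi>\<close> to
  \<open>J d\<close>, and \<open>k d\<close> norms \<open>d\<close>. Both properties persist near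
  \<open>d\<close>, so by density they reach every \<open>w\<close>.\<close>

lemma ex_determining_if_separable:
  assumes \<phi>: "\<phi> \<in> carr (dual (dual Y))" "nrm (dual (dual Y)) \<phi> = 1" "\<phi> \<notin> range J"
    and sep: "separable_space (norm_topology Y)"
  shows "\<exists>f. determining \<phi> f"
proof -
  from Y.separable_norm_topologyD[OF sep]
  obtain D where "countable D" "\<forall>x\<in>carr Y. \<forall>r>0. \<exists>y\<in>D. nrm Y (x - y) < r"
    by blast
  then have D: "countable D" "\<And>x r. 0 < r \<Longrightarrow> \<exists>y\<in>D. norm (x - y) < r"
    by (simp_all add: space_of_simps)
  let ?n = "nrm (dual (dual Y))"
  have diff: "\<phi> - J d \<in> carr (dual (dual Y))" for d
    by (rule Y''.diff_carr[OF \<phi>(1) J_in_bidual])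
  have pos: "0 < ?n (\<phi> - J d)" for d
  proof -
    have "\<phi> - J d \<noteq> 0"
      using \<phi>(3) by auto
    then show ?thesis
      using Y''.nrm_eq_zero[OF diff] Y''.nrm_nonneg[OF diff] by (metis order_less_le)
  qed
  have "\<exists>h\<in>unit_ball (dual Y). ?n (\<phi> - J d) / 2 < norm ((\<phi> - J d) h)" for d
    using Y'.less_nrm_dualD[of "?n (\<phi> - J d) / 2" "\<phi> - J d"] pos[of d] by linarith
  then have "\<exists>h. \<forall>d. h d \<in> unit_ball (dual Y) \<and> ?n (\<phi> - J d) / 2 < norm ((\<phi> - J d) (h d))"
    by (intro choice allI) blast
  then obtain h where h: "\<And>d. h d \<in> carr (dual Y)" "\<And>d. nrm (dual Y) (h d) \<le> 1"
    "\<And>d. ?n (\<phi> - J d) / 2 < norm ((\<phi> - J d) (h d))"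
    unfolding unit_ball_def mem_Collect_eq by blast
  have "\<exists>k. k \<in> carr (dual Y) \<and> nrm (dual Y) k \<le> 1 \<and> k d = of_real (norm d)" for d
    using ex_norming_in_dual[of d] by blast
  then have "\<exists>k. \<forall>d. k d \<in> carr (dual Y) \<and> nrm (dual Y) (k d) \<le> 1 \<and> k d d = of_real (norm d)"
    by (intro choice allI)
  then obtain k where k: "\<And>d. k d \<in> carr (dual Y)" "\<And>d. nrm (dual Y) (k d) \<le> 1"
    "\<And>d. k d d = of_real (norm d)"
    by blast
  have le: "norm (f x) \<le> norm x" if "f \<in> carr (dual Y)" "nrm (dual Y) f \<le> 1" for f x
    using functional_bound[OF that(1), of x] mult_right_mono[OF that(2) norm_ge_zero[of x]] by simp
  show ?thesis
  proof (rule ex_determiningI[OF \<phi>(1,2)])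
    show "countable (h ` D \<union> k ` D)" "h ` D \<union> k ` D \<subseteq> carr (dual Y)"
      using D(1) h(1) k(1) by auto
  next
    fix w
    let ?\<eta> = "?n (\<phi> - J w)"
    \<comment> \<open>Agreement of \<open>h d\<close> with \<open>\<phi>\<close> at \<open>w\<close>
      would give distance below \<open>?\<eta> / 2\<close> from \<open>\<phi>\<close> to
      \<open>J d\<close>, hence below \<open>3 * ?\<eta> / 4\<close> to \<open>J w\<close>,
      contradicting the choice of \<open>?\<eta>\<close>.\<close>
    obtain d where d: "d \<in> D" "norm (w - d) < ?\<eta> / 4"
      using D(2)[of "?\<eta> / 4" w] pos[of w] by auto
    have "h d w \<noteq> \<phi> (h d)"
    proof
      assume eq: "h d w = \<phi> (h d)"
      have "(\<phi> - J d) (h d) = h d (w - d)"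
        by (simp add: J_apply h(1) functional_diff eq)
      then have "norm ((\<phi> - J d) (h d)) < ?\<eta> / 4"
        using le[OF h(1,2), of d "w - d"] d(2) by simp
      moreover have "?\<eta> \<le> ?n (\<phi> - J d) + norm (d - w)"
        using Y''.nrm_triangle_diff[OF \<phi>(1) J_in_bidual J_in_bidual, of w d] nrm_J[of "d - w"]
        by (simp add: J_diff)
      ultimately show False
        using h(3)[of d] d(2) pos[of w] norm_minus_commute[of d w] by linarith
    qed
    with d(1) show "\<exists>f\<in>h ` D \<union> k ` D. f w \<noteq> \<phi> f"
      by blast
  next
    fix w assume zero: "\<And>f. f \<in> h ` D \<union> k ` D \<Longrightarrow> f w = 0"
    show "w = 0"
    proof (rule ccontr)
      assume "w \<noteq> 0"
      then obtain d where d: "d \<in> D" "norm (w - d) < norm w / 4"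
        using D(2)[of "norm w / 4" w] by auto
      \<comment> \<open>Vanishing of \<open>k d\<close> at \<open>w\<close> makes
        \<open>norm d\<close> at most \<open>norm (w - d)\<close>, so \<open>norm w\<close> would be
        less than half of itself.\<close>
      have "k d d = - k d (w - d)"
        using zero[of "k d"] d(1) by (simp add: functional_diff k(1))
      then have "norm d \<le> norm (w - d)"
        using le[OF k(1,2), of d "w - d"] k(3)[of d] by (metis abs_norm_cancel norm_minus_cancel norm_of_real)
      moreover have "norm w \<le> norm (w - d) + norm d"
        using norm_triangle_sub[of w d] by simp
      moreover have "0 < norm w"
        using \<open>w \<noteq> 0\<close> by simp
      ultimately show False
        using d(2) by linarith
    qed
  qed
qed

text \<open>A countable dense subset of the dual serves directly. Agreement of \<open>\<phi>\<close>
  with evaluation at \<open>w\<close> on it extends by continuity to the whole dual and would put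
  \<open>\<phi>\<close> in the range of \<open>J\<close>. If all its members vanish at
  \<open>w\<close>, one of them within 1/2 of a norming functional forces
  \<open>w = 0\<close>.\<close>

lemma ex_determining_if_separable_dual:
  assumes \<phi>: "\<phi> \<in> carr (dual (dual Y))" "nrm (dual (dual Y)) \<phi> = 1" "\<phi> \<notin> range J"
    and sep: "separable_space (norm_topology (dual Y))"
  shows "\<exists>f. determining \<phi> f"
proof -
  from Y'.separable_norm_topologyD[OF sep]
  obtain D where D: "countable D" "D \<subseteq> carr (dual Y)"
    "\<And>x r. x \<in> carr (dual Y) \<Longrightarrow> 0 < r \<Longrightarrow> \<exists>y\<in>D. nrm (dual Y) (x - y) < r"
    by blast
  show ?thesis
  proof (rule ex_determiningI[OF \<phi>(1,2) D(1,2)])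
    fix w
    show "\<exists>f\<in>D. f w \<noteq> \<phi> f"
    proof (rule ccontr)
      assume "\<not> ?thesis"
      then have eq: "d w = \<phi> d" if "d \<in> D" for d
        using that by blast
      have "\<phi> f = J w f" for f
      proof (cases "f \<in> carr (dual Y)")
        case f: True
        have "norm (\<phi> f - f w) \<le> e" if "0 < e" for e
        proof -
          have pos: "0 < 1 + norm w"
            by (simp add: add_pos_nonneg)
          \<comment> \<open>The error \<open>f - d\<close> is paid for twice, by
            \<open>\<phi>\<close> with factor 1 and by evaluation at \<open>w\<close> with factor
            \<open>norm w\<close>.\<close>
          obtain d where d: "d \<in> D" "nrm (dual Y) (f - d) < e / (1 + norm w)"
            using D(3)[OF f, of "e / (1 + norm w)"] \<open>0 < e\<close> pos by auto
          have dc: "d \<in> carr (dual Y)"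
            using d(1) D(2) by blast
          then have fd: "f - d \<in> carr (dual Y)"
            by (rule Y'.diff_carr[OF f])
          have "\<phi> f - f w = \<phi> (f - d) - (f - d) w"
            using eq[OF d(1)] by (simp add: Y'.dual_diff[OF \<phi>(1) f dc])
          also have "norm \<dots> \<le> norm (\<phi> (f - d)) + norm ((f - d) w)"
            by (rule norm_triangle_ineq4)
          also have "\<dots> \<le> nrm (dual Y) (f - d) * (1 + norm w)"
            using Y'.dual_bound[OF \<phi>(1) fd] functional_bound[OF fd, of w]
            by (simp add: \<phi>(2) algebra_simps)
          also have "\<dots> \<le> e"
            using d(2) pos by (simp add: field_simps)
          finally show ?thesis .
        qed
        then have "norm (\<phi> f - f w) \<le> 0"
          by (rule field_le_epsilon[of _ 0, simplified])
        with f show ?thesis by (simp add: J_apply)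
      next
        case False
        with dual_outside[OF \<phi>(1)] dual_outside[OF J_in_bidual] show ?thesis by simp
      qed
      with \<phi>(3) show False by blast
    qed
  next
    fix w assume zero: "\<And>f. f \<in> D \<Longrightarrow> f w = 0"
    obtain f where f: "f \<in> carr (dual Y)" "nrm (dual Y) f \<le> 1" "f w = of_real (norm w)"
      by (rule ex_norming_in_dual)
    obtain d where d: "d \<in> D" "nrm (dual Y) (f - d) < 1 / 2"
      using D(3)[OF f(1), of "1 / 2"] by auto
    have "norm ((f - d) w) \<le> nrm (dual Y) (f - d) * norm w"
      using d(1) D(2) by (intro functional_bound Y'.diff_carr f(1)) auto
    also have "\<dots> \<le> 1 / 2 * norm w"
      using d(2) by (intro mult_right_mono) auto
    finally show "w = 0"
      using zero[OF d(1)] f(3) by simp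
  qed
qed

end

section \<open>Operators on the space of summable sequences\<close>

locale banach_scaling = normed_scaling scaleK
  for scaleK :: "'k::real_or_complex \<Rightarrow> 'v::banach \<Rightarrow> 'v"

lemma ell1_simps:
  "a \<in> carr ell1 \<longleftrightarrow> summable (\<lambda>n. norm (a n))"
  "smul ell1 c a = (\<lambda>n. c * a n)"
  "nrm ell1 a = (\<Sum>n. norm (a n))"
  by (simp_all add: ell1_def)

lemma ell1_add_carr: "a \<in> carr ell1 \<Longrightarrow> b \<in> carr ell1 \<Longrightarrow> a + b \<in> carr ell1"
  unfolding ell1_simps
  by (rule summable_comparison_test'[OF summable_add[of "\<lambda>n. norm (a n)" "\<lambda>n. norm (b n)"], of 0])
    (auto simp: plus_fun_def norm_triangle_ineq)

lemma unit_vector_in_ell1_ball: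
  "(\<lambda>n. if n = k then 1 else 0) \<in> unit_ball (ell1 :: ('k::real_or_complex, nat \<Rightarrow> 'k) kspace)"
proof -
  have "(\<lambda>n. norm (if n = k then 1 else 0 :: 'k)) sums 1"
    using sums_single[of k "\<lambda>n. 1 :: real"] by (simp add: if_distrib cong: if_cong)
  then show ?thesis
    by (simp add: unit_ball_def ell1_simps sums_iff)
qed

context normed_scaling
begin

lemma bounded_linear_scaleK: "bounded_linear (scaleK c)"
proof (rule bounded_linear_intro[where K = "norm c"])
  show "scaleK c (r *\<^sub>R x) = r *\<^sub>R scaleK c x" for r x
    by (simp add: mult.commute flip: scale_of_real)
qed (simp_all add: scale_right_distrib norm_scale mult.commute)

lemma bounded_linear_functional:
  assumes f: "f \<in> carr (dual Y)"
  shows "bounded_linear f"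
proof (rule bounded_linear_intro[where K = "nrm (dual Y) f"])
  show "f (r *\<^sub>R x) = r *\<^sub>R f x" for r x
    using functional_scale[OF f, of "of_real r" x] by (simp add: scale_of_real scaleR_conv_of_real)
  show "f (x + y) = f x + f y" for x y
    by (rule functional_add[OF f])
  show "norm (f x) \<le> norm x * nrm (dual Y) f" for x
    using functional_bound[OF f, of x] by (simp add: mult.commute)
qed

end

section \<open>Synthesis operators and the mass estimate for their coefficients\<close>

context banach_scaling
begin

definition synthesis :: "(nat \<Rightarrow> 'v) \<Rightarrow> (nat \<Rightarrow> 'k) \<Rightarrow> 'v" where
  "synthesis x a = (\<Sum>n. scaleK (a n) (x n))"

text \<open>The synthesis operator followed by the canonical embedding; the value 0 off the carrier
  is the convention of \<open>bounded_operators\<close>.\<close>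

definition synthesis_bidual :: "(nat \<Rightarrow> 'v) \<Rightarrow> (nat \<Rightarrow> 'k) \<Rightarrow> ('v \<Rightarrow> 'k) \<Rightarrow> 'k" where
  "synthesis_bidual x a = (if a \<in> carr ell1 then J (synthesis x a) else 0)"

lemma synthesis_unit_vector: "synthesis x (\<lambda>n. if n = k then 1 else 0) = x k"
proof -
  have "(\<lambda>n. scaleK (if n = k then 1 else 0) (x n)) = (\<lambda>n. if n = k then x n else 0)"
    by auto
  then show ?thesis
    using sums_single[of k x] by (simp add: synthesis_def sums_iff)
qed

context
  fixes x :: "nat \<Rightarrow> 'v"
  assumes x: "\<And>n. norm (x n) \<le> 1"
begin

lemma summable_norm_mult:
  assumes "a \<in> carr ell1"
  shows "summable (\<lambda>n. norm (a n) * norm (x n))"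
  by (rule summable_comparison_test'[of "\<lambda>n. norm (a n)" 0])
    (use assms x in \<open>auto simp: ell1_simps mult_left_le\<close>)

lemma summable_synthesis: "a \<in> carr ell1 \<Longrightarrow> summable (\<lambda>n. scaleK (a n) (x n))"
  by (rule summable_norm_cancel) (simp add: norm_scale summable_norm_mult)

lemma norm_synthesis_le: "a \<in> carr ell1 \<Longrightarrow> norm (synthesis x a) \<le> (\<Sum>n. norm (a n) * norm (x n))"
  unfolding synthesis_def using summable_norm[of "\<lambda>n. scaleK (a n) (x n)"]
  by (simp add: norm_scale summable_norm_mult)

lemma norm_synthesis_le_nrm: "a \<in> carr ell1 \<Longrightarrow> norm (synthesis x a) \<le> nrm ell1 a"
proof -
  assume a: "a \<in> carr ell1"
  have "(\<Sum>n. norm (a n) * norm (x n)) \<le> (\<Sum>n. norm (a n))"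
    using a x by (intro suminf_le summable_norm_mult) (auto simp: ell1_simps mult_left_le)
  with norm_synthesis_le[OF a] show ?thesis
    by (simp add: ell1_simps)
qed

lemma synthesis_bidual_bounded: "synthesis_bidual x \<in> bounded_operators ell1 (dual (dual Y))"
proof -
  have scale: "a \<in> carr ell1 \<Longrightarrow> smul ell1 c a \<in> carr ell1" for a :: "nat \<Rightarrow> 'k" and c
    by (simp add: ell1_simps norm_mult summable_mult)
  have "synthesis x (a + b) = synthesis x a + synthesis x b" if "a \<in> carr ell1" "b \<in> carr ell1" for a b
    unfolding synthesis_def
    by (simp add: plus_fun_def scale_left_distrib suminf_add summable_synthesis that)
  moreover have "synthesis x (smul ell1 c a) = scaleK c (synthesis x a)" if "a \<in> carr ell1" for a c
    unfolding synthesis_def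
    by (simp add: ell1_simps bounded_linear.suminf[OF bounded_linear_scaleK summable_synthesis[OF that]])
  ultimately show ?thesis
    unfolding bounded_operators_def synthesis_bidual_def
    using norm_synthesis_le_nrm
    by (auto simp: J_in_bidual ell1_add_carr scale J_add J_scale nrm_J intro!: exI[of _ 1])
qed

lemma synthesis_bidual_unit_ball:
  "synthesis_bidual x ` unit_ball ell1 = J ` synthesis x ` unit_ball ell1"
  by (auto simp: synthesis_bidual_def unit_ball_def image_image intro!: image_cong)

text \<open>Late indices contribute at most \<open>e\<close> in total. At an early index the loss
  \<open>1 - norm (x n)\<close> is at least \<open>1 / (N + 1)\<close>, so \<open>C\<close> is at
  most \<open>C * (N + 1)\<close> times this loss. The weighted losses sum to at most
  \<open>1 - norm (synthesis x a)\<close>, whence early indices matter little when the image has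
  norm near 1.\<close>

lemma functional_synthesis_bound:
  assumes f: "f \<in> carr (dual Y)" and a: "a \<in> unit_ball ell1"
    and xN: "\<And>n. norm (x n) \<le> 1 - 1 / real (n + 2)"
    and C: "0 \<le> C" "\<And>n. norm (f (x n)) \<le> C"
    and e: "0 \<le> e" "\<And>n. N \<le> n \<Longrightarrow> norm (f (x n)) \<le> e"
  shows "norm (f (synthesis x a)) \<le> e + C * real (N + 1) * (1 - norm (synthesis x a))"
proof -
  have a1: "a \<in> carr ell1" "summable (\<lambda>n. norm (a n))" "(\<Sum>n. norm (a n)) \<le> 1"
    using a by (auto simp: unit_ball_def ell1_simps)
  let ?K = "C * real (N + 1)"
  have K: "0 \<le> ?K"
    using C(1) by simp
  let ?b = "\<lambda>n. e * norm (a n) + ?K * (norm (a n) - norm (a n) * norm (x n))"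
  have pointwise: "norm (a n * f (x n)) \<le> ?b n" for n
  proof -
    have "norm (f (x n)) \<le> e + ?K * (1 - norm (x n))"
    proof (cases "N \<le> n")
      case True
      have "0 \<le> ?K * (1 - norm (x n))"
        by (rule mult_nonneg_nonneg[OF K]) (use x[of n] in simp)
      with e(2)[OF True] show ?thesis by linarith
    next
      case False
      \<comment> \<open>From \<open>n < N\<close> one gets \<open>n + 2 \<le> N + 1\<close>, which
        is why the factor is \<open>N + 1\<close>.\<close>
      have "1 / real (N + 1) \<le> 1 / real (n + 2)"
        using False by (intro divide_left_mono) auto
      with xN[of n] have "1 / real (N + 1) \<le> 1 - norm (x n)"
        by linarith
      then have "?K * (1 / real (N + 1)) \<le> ?K * (1 - norm (x n))"
        using K by (rule mult_left_mono)
      moreover have "?K * (1 / real (N + 1)) = C"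
        by simp
      ultimately show ?thesis
        using C(2)[of n] e(1) by linarith
    qed
    from mult_left_mono[OF this norm_ge_zero[of "a n"]] show ?thesis
      by (simp add: norm_mult algebra_simps)
  qed
  have b_sum: "summable ?b"
    by (intro summable_add summable_mult summable_diff a1 summable_norm_mult)
  have "(\<lambda>n. a n * f (x n)) sums f (synthesis x a)"
    using bounded_linear.sums[OF bounded_linear_functional[OF f]
        summable_sums[OF summable_synthesis[OF a1(1)]]]
    by (simp add: synthesis_def functional_scale[OF f])
  then have "(\<lambda>m. norm (\<Sum>n<m. a n * f (x n))) \<longlonglongrightarrow> norm (f (synthesis x a))"
    unfolding sums_def by (rule tendsto_norm)
  moreover have "norm (\<Sum>n<m. a n * f (x n)) \<le> suminf ?b" for m
  proof -
    have "norm (\<Sum>n<m. a n * f (x n)) \<le> sum ?b {..<m}"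
      using pointwise by (rule sum_norm_le)
    also have "\<dots> \<le> suminf ?b"
      using pointwise by (intro sum_le_suminf b_sum) (auto intro: order_trans[OF norm_ge_zero])
    finally show ?thesis .
  qed
  ultimately have "norm (f (synthesis x a)) \<le> suminf ?b"
    by (intro LIMSEQ_le_const2) auto
  also have "\<dots> = e * (\<Sum>n. norm (a n)) + ?K * ((\<Sum>n. norm (a n)) - (\<Sum>n. norm (a n) * norm (x n)))"
  proof (rule sums_unique[symmetric])
    show "?b sums (e * (\<Sum>n. norm (a n))
        + ?K * ((\<Sum>n. norm (a n)) - (\<Sum>n. norm (a n) * norm (x n))))"
      by (intro sums_add sums_mult sums_diff summable_sums a1 summable_norm_mult)
  qed
  also have "\<dots> \<le> e * 1 + ?K * (1 - norm (synthesis x a))"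
    using norm_synthesis_le[OF a1(1)] a1(3) e(1) K by (intro add_mono mult_left_mono) auto
  finally show ?thesis by simp
qed

end

text \<open>Goldstine's theorem is applied at stage \<open>n\<close> to \<open>f 0, ..., f n\<close>
  with error \<open>1 / (n + 1)\<close>. Every fixed functional is included from some stage on, so
  convergence holds for each. The points are then shrunk by factors \<open>l n\<close> that tend to
  1: limits are unchanged while the norms stay strictly below 1.\<close>

lemma ex_approximating_sequence:
  fixes f :: "nat \<Rightarrow> 'v \<Rightarrow> 'k"
  assumes \<phi>: "\<phi> \<in> carr (dual (dual Y))" "nrm (dual (dual Y)) \<phi> = 1"
    and f: "\<And>i. f i \<in> carr (dual Y)"
  shows "\<exists>x. (\<forall>n. norm (x n) \<le> 1 - 1 / real (n + 2)) \<and> (\<forall>i. (\<lambda>n. f i (x n)) \<longlonglongrightarrow> \<phi> (f i))"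
proof -
  have "\<exists>y. norm y \<le> 1 \<and> (\<forall>g\<in>f ` {..n}. norm (g y - \<phi> g) < 1 / real (Suc n))" for n :: nat
    using f \<phi> by (intro Goldstine) auto
  then have "\<exists>y. \<forall>n. norm (y n) \<le> 1 \<and> (\<forall>g\<in>f ` {..n}. norm (g (y n) - \<phi> g) < 1 / real (Suc n))"
    by (intro choice allI)
  then obtain y where y: "\<And>n. norm (y n) \<le> 1"
    "\<And>n g. g \<in> f ` {..n} \<Longrightarrow> norm (g (y n) - \<phi> g) < 1 / real (Suc n)"
    by blast
  define l where "l n = 1 - 1 / real (n + 2)" for n
  have l: "0 \<le> l n" for n
    by (simp add: l_def)
  show ?thesis
  proof (intro exI[of _ "\<lambda>n. scaleK (of_real (l n)) (y n)"] conjI allI)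
    fix n
    show "norm (scaleK (of_real (l n)) (y n)) \<le> 1 - 1 / real (n + 2)"
      using mult_left_mono[OF y(1)[of n] l[of n]] l[of n]
      unfolding l_def[symmetric] by (simp add: norm_scale)
  next
    fix i
    have "(\<lambda>n. f i (y n) - \<phi> (f i)) \<longlonglongrightarrow> 0"
    proof (rule Lim_null_comparison[OF _ LIMSEQ_inverse_real_of_nat])
      show "eventually (\<lambda>n. norm (f i (y n) - \<phi> (f i)) \<le> inverse (real (Suc n))) sequentially"
      proof (rule eventually_sequentiallyI)
        fix n assume "i \<le> n"
        then show "norm (f i (y n) - \<phi> (f i)) \<le> inverse (real (Suc n))"
          using y(2)[of "f i" n] by (simp add: inverse_eq_divide)
      qed
    qed
    then have "(\<lambda>n. f i (y n)) \<longlonglongrightarrow> \<phi> (f i)"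
      by (simp add: LIM_zero_iff)
    moreover have "l \<longlonglongrightarrow> 1"
    proof -
      have "(\<lambda>n. 1 / real (n + 2)) \<longlonglongrightarrow> 0"
        using LIMSEQ_ignore_initial_segment[OF lim_1_over_n, of 2] by simp
      from tendsto_diff[OF tendsto_const[of 1] this] show ?thesis
        unfolding l_def by simp
    qed
    then have "(\<lambda>n. of_real (l n) :: 'k) \<longlonglongrightarrow> of_real 1"
      by (rule tendsto_of_real)
    ultimately have "(\<lambda>n. of_real (l n) * f i (y n)) \<longlonglongrightarrow> of_real 1 * \<phi> (f i)"
      by (intro tendsto_mult)
    then show "(\<lambda>n. f i (scaleK (of_real (l n)) (y n))) \<longlonglongrightarrow> \<phi> (f i)"
      by (simp add: functional_scale[OF f])
  qed
qed

section \<open>The operator given by the approximating sequence and its two attainment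
  properties\<close>

context
  fixes \<phi> f x
  assumes \<phi>: "\<phi> \<in> carr (dual (dual Y))" "nrm (dual (dual Y)) \<phi> = 1"
    and det: "determining \<phi> f"
    and x_norm: "\<And>n. norm (x n) \<le> 1 - 1 / real (n + 2)"
    and x_lim: "\<And>i. (\<lambda>n. f i (x n)) \<longlonglongrightarrow> \<phi> (f i)"
begin

lemma x_le_1: "norm (x n) \<le> 1"
  by (rule order_trans[OF x_norm]) simp

lemma f_dual: "f i \<in> carr (dual Y)"
  using det by (simp add: determining_def)

lemma norming_index: "c < 1 \<Longrightarrow> \<exists>i. nrm (dual Y) (f i) \<le> 1 \<and> c < norm (\<phi> (f i))"
  using det by (simp add: determining_def)

text \<open>For the lower bound, unit vectors are sent to the \<open>x n\<close>, whose norms exceed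
  any \<open>c < 1\<close> for suitable \<open>n\<close>, because a norming \<open>f i\<close> takes
  values at \<open>x n\<close> approaching \<open>\<phi> (f i)\<close>.\<close>

lemma nrm_synthesis_bidual:
  "nrm (operator_space ell1 (dual (dual Y))) (synthesis_bidual x) = 1"
proof -
  have eq: "nrm (operator_space ell1 (dual (dual Y))) (synthesis_bidual x)
      = (SUP a\<in>unit_ball ell1. norm (synthesis x a))"
    unfolding operator_space_def
    by (auto simp: synthesis_bidual_def unit_ball_def nrm_J intro!: arg_cong[where f = Sup] image_cong)
  have le: "norm (synthesis x a) \<le> 1" if "a \<in> unit_ball ell1" for a
    using norm_synthesis_le_nrm[of x a, OF x_le_1] that by (auto simp: unit_ball_def)
  then have bdd: "bdd_above ((\<lambda>a. norm (synthesis x a)) ` unit_ball ell1)"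
    by (intro bdd_aboveI2)
  have "c \<le> (SUP a\<in>unit_ball ell1. norm (synthesis x a))" if c: "c < 1" for c
  proof -
    obtain i where i: "nrm (dual Y) (f i) \<le> 1" "c < norm (\<phi> (f i))"
      using norming_index[OF c] by blast
    have "eventually (\<lambda>n. c < norm (f i (x n))) sequentially"
      by (rule order_tendstoD(1)[OF tendsto_norm[OF x_lim] i(2)])
    then obtain n where n: "c < norm (f i (x n))"
      by (meson eventually_sequentially order_refl)
    have "norm (f i (x n)) \<le> 1 * norm (x n)"
      using functional_bound[OF f_dual, of i "x n"] i(1) by (meson mult_right_mono norm_ge_zero order_trans)
    also have "norm (x n) \<le> (SUP a\<in>unit_ball ell1. norm (synthesis x a))"
      using cSUP_upper[OF unit_vector_in_ell1_ball[of n] bdd] by (simp add: synthesis_unit_vector)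
    finally show ?thesis using n by simp
  qed
  then have "1 \<le> (SUP a\<in>unit_ball ell1. norm (synthesis x a))"
    by (rule dense_le)
  moreover have "(SUP a\<in>unit_ball ell1. norm (synthesis x a)) \<le> 1"
    using le unit_vector_in_ell1_ball by (intro cSUP_least) auto
  ultimately show ?thesis
    using eq by simp
qed

lemma synthesis_bidual_wstar_QNA: "synthesis_bidual x \<in> wstar_QNA ell1 (dual Y)"
proof -
  obtain u where u: "u \<in> carr (dual (dual Y))" "nrm (dual (dual Y)) u \<le> 1"
    and cluster: "\<And>F e N. finite F \<Longrightarrow> 0 < e \<Longrightarrow> \<exists>n\<ge>N. \<forall>g\<in>F. norm (J (x n) g - u g) < e"
    using Y'.dual_sequence_cluster_point[of "\<lambda>n. J (x n)"] J_in_bidual x_le_1 by (auto simp: nrm_J)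
  have u_f: "u (f i) = \<phi> (f i)" for i
  proof -
    have "norm (u (f i) - \<phi> (f i)) \<le> e" if e: "0 < e" for e
    proof -
      have "eventually (\<lambda>n. dist (f i (x n)) (\<phi> (f i)) < e / 2) sequentially"
        using x_lim[of i] e by (intro tendstoD) auto
      then obtain N where N: "\<And>n. N \<le> n \<Longrightarrow> norm (f i (x n) - \<phi> (f i)) < e / 2"
        by (auto simp: eventually_sequentially dist_norm)
      \<comment> \<open>The cluster property provides an index beyond \<open>N\<close>, where
        convergence to \<open>\<phi> (f i)\<close> is already accurate.\<close>
      obtain n where n: "N \<le> n" "norm (J (x n) (f i) - u (f i)) < e / 2"
        using cluster[of "{f i}" "e / 2" N] e by auto
      have "norm (u (f i) - \<phi> (f i)) \<le> norm (u (f i) - f i (x n)) + norm (f i (x n) - \<phi> (f i))"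
        using norm_triangle_ineq[of "u (f i) - f i (x n)" "f i (x n) - \<phi> (f i)"] by simp
      with N[OF n(1)] n(2) show ?thesis
        by (simp add: J_apply f_dual norm_minus_commute)
    qed
    then have "norm (u (f i) - \<phi> (f i)) \<le> 0"
      by (rule field_le_epsilon[of _ 0, simplified])
    then show ?thesis by simp
  qed
  \<comment> \<open>Agreeing with \<open>\<phi>\<close> on a norming sequence, \<open>u\<close>
    inherits the lower bound for its norm.\<close>
  have "c \<le> nrm (dual (dual Y)) u" if c: "c < 1" for c
  proof -
    obtain i where i: "nrm (dual Y) (f i) \<le> 1" "c < norm (\<phi> (f i))"
      using norming_index[OF c] by blast
    moreover have "norm (u (f i)) \<le> nrm (dual (dual Y)) u"
      using i(1) f_dual by (intro Y'.nrm_dual_upper[OF u(1)]) (simp add: unit_ball_def)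
    ultimately show ?thesis
      by (simp add: u_f)
  qed
  then have "1 \<le> nrm (dual (dual Y)) u"
    by (rule dense_le)
  with u(2) have nrm_u: "nrm (dual (dual Y)) u = 1"
    by simp
  have "u \<in> weak_star_topology (dual Y) closure_of (synthesis_bidual x ` unit_ball ell1)"
  proof (rule Y'.in_weak_star_closure_ofI[OF u(1)])
    show "synthesis_bidual x ` unit_ball ell1 \<subseteq> carr (dual (dual Y))"
      by (auto simp: synthesis_bidual_unit_ball[of x, OF x_le_1] J_in_bidual)
    fix F :: "('v \<Rightarrow> 'k) set" and e :: real
    assume "finite F" "0 < e"
    then obtain n where n: "\<forall>g\<in>F. norm (J (x n) g - u g) < e"
      using cluster by blast
    have "J (x n) \<in> synthesis_bidual x ` unit_ball ell1"
      unfolding synthesis_bidual_unit_ball[of x, OF x_le_1]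
      using unit_vector_in_ell1_ball[of n] synthesis_unit_vector[of x n] by (metis imageI)
    with n show "\<exists>v\<in>synthesis_bidual x ` unit_ball ell1. \<forall>z\<in>F. norm (v z - u z) < e"
      by blast
  qed
  then show ?thesis
    unfolding wstar_QNA_def
    using synthesis_bidual_bounded[of x, OF x_le_1] u(1) nrm_u nrm_synthesis_bidual by auto
qed

text \<open>Since \<open>\<parallel>x n\<parallel> \<le> 1 - 1 / (n + 2)\<close>, coefficient sequences whose image has norm close to 1 carry
  almost all their mass on late indices, where \<open>f i (x n)\<close> is close to \<open>\<phi> (f i)\<close>. Hence a limit
  \<open>w\<close> of norm 1 satisfies \<open>f i w = c * \<phi> (f i)\<close> for all \<open>i\<close>.\<close>

lemma synthesis_bidual_not_QNA: "synthesis_bidual x \<notin> QNA ell1 (dual Y)"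
proof
  let ?n = "nrm (dual (dual Y))"
  assume "synthesis_bidual x \<in> QNA ell1 (dual Y)"
  then obtain z where
    z: "z \<in> norm_topology (dual (dual Y)) closure_of (synthesis_bidual x ` unit_ball ell1)"
    and nz: "?n z = 1"
    unfolding QNA_def by (auto simp: nrm_synthesis_bidual)
  have zc: "z \<in> carr (dual (dual Y))"
    using z by (simp add: Y''.norm_closure_of_iff)
  have "\<exists>a. a \<in> unit_ball ell1 \<and> ?n (z - J (synthesis x a)) < 1 / real (Suc k)" for k
  proof -
    have "0 < 1 / real (Suc k)" by simp
    with z show ?thesis
      unfolding Y''.norm_closure_of_iff synthesis_bidual_unit_ball[of x, OF x_le_1] by blast
  qed
  then have "\<exists>a. \<forall>k. a k \<in> unit_ball ell1 \<and> ?n (z - J (synthesis x (a k))) < 1 / real (Suc k)"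
    by (intro choice allI)
  then obtain a where a: "\<And>k. a k \<in> unit_ball ell1"
    and az: "\<And>k. ?n (z - J (synthesis x (a k))) < 1 / real (Suc k)"
    by blast
  define s where "s k = synthesis x (a k)" for k
  have dist_s: "norm (s k - s m) \<le> 1 / real (Suc k) + 1 / real (Suc m)" for k m
  proof -
    have "norm (s k - s m) \<le> ?n (J (s k) - z) + ?n (z - J (s m))"
      using Y''.nrm_triangle_diff[OF J_in_bidual zc J_in_bidual, of "s k" "s m"] nrm_J[of "s k - s m"]
      by (simp add: J_diff)
    with az[of k] az[of m] show ?thesis
      using Y''.nrm_minus_commute[OF J_in_bidual zc, of "s k"] by (simp add: s_def)
  qed
  \<comment> \<open>Since \<open>J\<close> is isometric, norm convergence in the bidual makes the
    preimages Cauchy, and completeness yields a limit \<open>w\<close> in the space itself.\<close>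
  have "Cauchy s"
  proof (rule metric_CauchyI)
    fix e :: real assume "0 < e"
    then obtain N where N: "1 / real (Suc N) < e / 2"
      using nat_approx_posE[of "e / 2"] by auto
    have "dist (s k) (s m) < e" if "N \<le> k" "N \<le> m" for k m
    proof -
      have "1 / real (Suc k) \<le> 1 / real (Suc N)" "1 / real (Suc m) \<le> 1 / real (Suc N)"
        using that by (auto intro!: divide_left_mono)
      with dist_s[of k m] N show ?thesis
        unfolding dist_norm by linarith
    qed
    then show "\<exists>M. \<forall>m\<ge>M. \<forall>n\<ge>M. dist (s m) (s n) < e"
      by blast
  qed
  then obtain w where w: "s \<longlonglongrightarrow> w"
    using Cauchy_convergent convergent_def by blast
  have norm_s: "(\<lambda>k. norm (s k)) \<longlonglongrightarrow> 1"
  proof -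
    have "(\<lambda>k. norm (s k) - 1) \<longlonglongrightarrow> 0"
    proof (rule Lim_null_comparison[OF always_eventually LIMSEQ_inverse_real_of_nat], rule allI)
      fix k
      have "1 \<le> norm (s k) + ?n (z - J (s k))" "norm (s k) \<le> 1 + ?n (J (s k) - z)"
        using Y''.nrm_le_add_diff[OF zc J_in_bidual, of "s k"]
          Y''.nrm_le_add_diff[OF J_in_bidual zc, of "s k"] nz by (simp_all add: nrm_J)
      moreover have "?n (J (s k) - z) = ?n (z - J (s k))"
        by (rule Y''.nrm_minus_commute[OF J_in_bidual zc])
      moreover have "?n (z - J (s k)) < inverse (real (Suc k))"
        using az[of k] by (simp add: s_def inverse_eq_divide)
      ultimately show "norm (norm (s k) - 1) \<le> inverse (real (Suc k))"
        unfolding real_norm_def by linarith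
    qed
    then show ?thesis
      by (simp add: LIM_zero_iff)
  qed
  have norm_w: "norm w = 1"
    using LIMSEQ_unique[OF tendsto_norm[OF w] norm_s] .
  \<comment> \<open>With \<open>N\<close> and \<open>C\<close> fixed by the convergence of
    \<open>g (x n)\<close> to 0, the mass estimate applies to every \<open>s k\<close>, and its
    factor \<open>1 - norm (s k)\<close> tends to 0.\<close>
  have vanish: "g w = 0" if g: "g \<in> carr (dual Y)" and lim: "(\<lambda>n. g (x n)) \<longlonglongrightarrow> 0" for g
  proof -
    have "(\<lambda>k. g (s k)) \<longlonglongrightarrow> 0"
    proof (rule LIMSEQ_I)
      fix e :: real assume e: "0 < e"
      have "eventually (\<lambda>n. dist (g (x n)) 0 < e / 2) sequentially"
        using lim e by (intro tendstoD) auto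
      then obtain N where N: "\<And>n. N \<le> n \<Longrightarrow> norm (g (x n)) \<le> e / 2"
        by (auto simp: eventually_sequentially intro: less_imp_le)
      have "Bseq (\<lambda>n. g (x n))"
        using lim by (intro convergent_imp_Bseq convergentI)
      then obtain C where C: "0 < C" "\<And>n. norm (g (x n)) \<le> C"
        unfolding Bseq_def by blast
      let ?K = "C * real (N + 1)"
      have "(\<lambda>k. ?K * (1 - norm (s k))) \<longlonglongrightarrow> ?K * (1 - 1)"
        by (intro tendsto_intros norm_s)
      then have "eventually (\<lambda>k. ?K * (1 - norm (s k)) < e / 2) sequentially"
        using e by (intro order_tendstoD(2)) auto
      then obtain M where M: "\<And>k. M \<le> k \<Longrightarrow> ?K * (1 - norm (s k)) < e / 2"
        by (auto simp: eventually_sequentially)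
      have "norm (g (s k)) < e" if "M \<le> k" for k
      proof -
        have "norm (g (s k)) \<le> e / 2 + ?K * (1 - norm (s k))"
          unfolding s_def using e C(1)
          by (intro functional_synthesis_bound[of x, OF x_le_1 g a x_norm _ C(2) _ N]) auto
        with M[OF that] show ?thesis by linarith
      qed
      then show "\<exists>M. \<forall>k\<ge>M. norm (g (s k) - 0) < e"
        by auto
    qed
    with bounded_linear.tendsto[OF bounded_linear_functional[OF g] w] show ?thesis
      by (rule LIMSEQ_unique)
  qed
  obtain i0 where i0: "\<phi> (f i0) \<noteq> 0"
    using norming_index[of 0] by auto
  define c where "c = f i0 w / \<phi> (f i0)"
  have f_w: "f i w = c * \<phi> (f i)" for i
  proof -
    \<comment> \<open>The combination of \<open>f i\<close> and \<open>f i0\<close> whose values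
      along \<open>x n\<close> tend to 0, so that \<open>vanish\<close> yields proportionality at
      \<open>w\<close>.\<close>
    define g where "g = smul (dual Y) (\<phi> (f i0)) (f i) - smul (dual Y) (\<phi> (f i)) (f i0)"
    have g_apply: "g y = \<phi> (f i0) * f i y - \<phi> (f i) * f i0 y" for y
      by (simp add: g_def dual_simps(2))
    have "(\<lambda>n. g (x n)) \<longlonglongrightarrow> \<phi> (f i0) * \<phi> (f i) - \<phi> (f i) * \<phi> (f i0)"
      unfolding g_apply by (intro tendsto_intros x_lim)
    then have "(\<lambda>n. g (x n)) \<longlonglongrightarrow> 0"
      by (simp add: mult.commute)
    moreover have "g \<in> carr (dual Y)"
      unfolding g_def by (intro Y'.diff_carr Y'.smul_carr f_dual)
    ultimately have "g w = 0"
      by (intro vanish)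
    with i0 show ?thesis
      by (simp add: g_apply c_def field_simps)
  qed
  show False
  proof (cases "c = 0")
    case True
    then have "\<forall>i. f i w = 0"
      by (simp add: f_w)
    with det have "w = 0"
      by (simp add: determining_def)
    with norm_w show False by simp
  next
    case False
    then have "f i (scaleK (1 / c) w) = \<phi> (f i)" for i
      by (simp add: functional_scale[OF f_dual] f_w)
    with det show False
      unfolding determining_def by blast
  qed
qed

end

section \<open>From a determining sequence and non-reflexivity to the separation of the two
  classes\<close>

lemma QNA_ne_wstar_QNA:
  assumes "\<phi> \<in> carr (dual (dual Y))" "nrm (dual (dual Y)) \<phi> = 1" "determining \<phi> f"
  shows "QNA (ell1 :: ('k, nat \<Rightarrow> 'k) kspace) (dual Y) \<noteq> wstar_QNA ell1 (dual Y)"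
proof -
  have "\<And>i. f i \<in> carr (dual Y)"
    using assms(3) by (simp add: determining_def)
  from ex_approximating_sequence[of \<phi> f, OF assms(1,2) this] obtain x
    where "\<And>n. norm (x n) \<le> 1 - 1 / real (n + 2)" "\<And>i. (\<lambda>n. f i (x n)) \<longlonglongrightarrow> \<phi> (f i)"
    by blast
  note x = assms this
  from synthesis_bidual_wstar_QNA[OF x] synthesis_bidual_not_QNA[OF x] show ?thesis
    by blast
qed

end

text \<open>The range of \<open>J\<close> is closed under scalar multiples, so an element outside it
  stays outside after normalization.\<close>

lemma (in normed_scaling) ex_normalized_non_canonical:
  assumes "\<not> reflexive Y"
  obtains \<phi> where "\<phi> \<in> carr (dual (dual Y))" "nrm (dual (dual Y)) \<phi> = 1" "\<phi> \<notin> range J"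
proof -
  let ?n = "nrm (dual (dual Y))"
  have "J ` carr Y \<subseteq> carr (dual (dual Y))"
    using J_in_bidual by blast
  with assms obtain \<psi> where \<psi>: "\<psi> \<in> carr (dual (dual Y))" "\<psi> \<notin> range J"
    unfolding reflexive_def space_of_simps by blast
  have "J 0 = 0"
    using J_diff[of 0 0] by simp
  with \<psi>(2) have "\<psi> \<noteq> 0"
    by (metis rangeI)
  then have pos: "0 < ?n \<psi>"
    using Y''.nrm_nonneg[OF \<psi>(1)] Y''.nrm_eq_zero[OF \<psi>(1)] by fastforce
  let ?\<phi> = "smul (dual (dual Y)) (of_real (1 / ?n \<psi>)) \<psi>"
  show thesis
  proof (rule that)
    show "?\<phi> \<in> carr (dual (dual Y))"
      by (rule Y''.smul_carr[OF \<psi>(1)])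
    show "?n ?\<phi> = 1"
      using pos unfolding Y''.nrm_smul[OF \<psi>(1)] norm_of_real by simp
    show "?\<phi> \<notin> range J"
    proof
      assume "?\<phi> \<in> range J"
      then obtain w where w: "?\<phi> = J w"
        by blast
      have "\<psi> = smul (dual (dual Y)) (of_real (?n \<psi>)) ?\<phi>"
        using pos by (auto simp: dual_simps(2))
      also have "\<dots> = J (scaleK (of_real (?n \<psi>)) w)"
        unfolding w J_scale ..
      finally show False
        using \<psi>(2) by blast
    qed
  qed
qed

theorem theorem4p2:
  fixes scaleK :: "'k::real_or_complex \<Rightarrow> 'y::banach \<Rightarrow> 'y"
  defines "Y \<equiv> space_of scaleK"
  assumes "normed_scaling scaleK" and "\<not> reflexive Y"
  shows "(separable_space (norm_topology Y) \<and> \<not> contains_copy_of Y (ell1 :: ('k, nat \<Rightarrow> 'k) kspace)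
           \<longrightarrow> QNA (ell1 :: ('k, nat \<Rightarrow> 'k) kspace) (dual Y) \<noteq> wstar_QNA ell1 (dual Y))
       \<and> (separable_space (norm_topology (dual Y))
           \<longrightarrow> QNA (ell1 :: ('k, nat \<Rightarrow> 'k) kspace) (dual Y) \<noteq> wstar_QNA ell1 (dual Y))"
proof -
  interpret normed_scaling scaleK by fact
  interpret banach_scaling scaleK by unfold_locales
  obtain \<phi> where \<phi>: "\<phi> \<in> carr (dual (dual Y))" "nrm (dual (dual Y)) \<phi> = 1"
    "\<phi> \<notin> range (canonical_embedding Y)"
    using ex_normalized_non_canonical[OF assms(3)[unfolded Y_def]] unfolding Y_def by metis
  \<comment> \<open>Either separability assumption yields a determining sequence for the same
    \<open>\<phi>\<close>, after which the argument is common.\<close>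
  from ex_determining_if_separable[OF \<phi>[unfolded Y_def]]
    ex_determining_if_separable_dual[OF \<phi>[unfolded Y_def]]
    QNA_ne_wstar_QNA[OF \<phi>(1,2)[unfolded Y_def]]
  show ?thesis
    unfolding Y_def by blast
qed

end
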